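(* Let $\nu\in\widehat{\mathcal{D}}$. Then there is a radial weight $\omega$ such that $P_\omega: L^\infty_{\widehat{\nu}}\to H^\infty_{\widehat{\nu}}$ is bounded if and only if $\nu\in\check{\mathcal{D}}$. In particular, if $\nu\in\widehat{\mathcal{D}}\setminus\check{\mathcal{D}}$ and $\omega$ is a radial weight, then $P_\omega$ is not bounded from $L^\infty_{\widehat{\nu}}$ to $H^\infty_{\widehat{\nu}}$.
   Context: Let $\mathbb{D}$ be the open unit disc of $\mathbb{C}$, $\mathcal{H}(\mathbb{D})$ the space of analytic functions in $\mathbb{D}$, and $dA(z)=\frac{dx\,dy}{\pi}$ the normalized area measure. A radial weight is a nonnegative function $\omega\in L^1([0,1))$, extended to $\mathbb{D}$ by $\omega(z)=\omega(|z|)$. Write $\widehat{\omega}(z)=\widehat{\omega}(|z|)=\int_{|z|}^1\omega(s)\,ds$; it is assumed throughout that $\widehat{\omega}(z)>0$ for all $z\in\mathbb{D}$. The moments are $\omega_x=\int_0^1 r^x\omega(r)\,dr$, $x\ge0$. A radial weight $\omega$ belongs to $\widehat{\mathcal{D}}$ if there is $C>0$ such that $\widehat{\omega}(r)\le C\,\widehat{\omega}\left(\frac{1+r}{2}\right)$ as $r\to1^-$ (i.e. for all $r<1$ close enough to $1$). It belongs to $\check{\mathcal{D}}$ if there are $K>1$ and $C>1$ such that $\widehat{\omega}(r)\ge C\,\widehat{\omega}\left(1-\frac{1-r}{K}\right)$ as $r\to1^-$. For a radial weight $\omega$, the Bergman projection is $$P_\omega(f)(z)=\int_{\mathbb{D}}f(\zeta)\,\overline{B^\omega_z(\zeta)}\,\omega(\zeta)\,dA(\zeta),\qquad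 B^\omega_z(\zeta)=\sum_{n=0}^\infty\frac{(\overline{z}\zeta)^n}{2\omega_{2n+1}},$$ where $B^\omega_z$ is the reproducing kernel of the Bergman space $A^2_\omega=L^2(\mathbb{D},\omega\,dA)\cap\mathcal{H}(\mathbb{D})$. For a radial weight $\nu$, $L^\infty_{\widehat{\nu}}$ is the space of measurable $f:\mathbb{D}\to\mathbb{C}$ with $\|f\|_{\infty,\widehat{\nu}}=\operatorname{ess\,sup}_{z\in\mathbb{D}}|f(z)|\widehat{\nu}(z)<\infty$, and $H^\infty_{\widehat{\nu}}=L^\infty_{\widehat{\nu}}\cap\mathcal{H}(\mathbb{D})$. Boundedness of $P_\omega:X\to Y$ means that for every $f\in X$ the integral $\int_{\mathbb{D}}f(\zeta)\,\overline{B^\omega_z(\zeta)}\,\omega(\zeta)\,dA(\zeta)$, as a function of $z\in\mathbb{D}$, defines an element of $Y$, and $\|P_\omega f\|_Y\le C\|f\|_X$ with $C$ independent of $f$. *)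

theory Defs
  imports "HOL-Probability.Essential_Supremum"
begin

text \<open>
  A radial weight on the unit disc is represented by its profile on \<open>[0,1)\<close>; the weight at \<open>z\<close> is
  \<open>\<omega> (cmod z)\<close>. Values of the profile outside \<open>[0,1)\<close> are never used, and neither are the
  values outside \<open>ball 0 1\<close> of a complex function representing a function on the disc.
\<close>

definition tail :: "(real \<Rightarrow> real) \<Rightarrow> real \<Rightarrow> real" where
  "tail \<omega> r = (LINT s|lebesgue_on {r..<1}. \<omega> s)"

definition radial_weight :: "(real \<Rightarrow> real) \<Rightarrow> bool" where
  "radial_weight \<omega> \<longleftrightarrow>
     (\<forall>r\<in>{0..<1}. 0 \<le> \<omega> r) \<and>
     integrable (lebesgue_on {0..<1}) \<omega> \<and>
     (\<forall>z\<in>ball (0::complex) 1. 0 < tail \<omega> (cmod z))"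

definition D_hat :: "(real \<Rightarrow> real) set" where
  "D_hat = {\<omega>. radial_weight \<omega> \<and>
     (\<exists>C>0. \<forall>\<^sub>F r in at_left 1. tail \<omega> r \<le> C * tail \<omega> ((1 + r) / 2))}"

definition D_check :: "(real \<Rightarrow> real) set" where
  "D_check = {\<omega>. radial_weight \<omega> \<and>
     (\<exists>K>1. \<exists>C>1. \<forall>\<^sub>F r in at_left 1. tail \<omega> r \<ge> C * tail \<omega> (1 - (1 - r) / K))}"

definition moment :: "(real \<Rightarrow> real) \<Rightarrow> real \<Rightarrow> real" where
  "moment \<omega> x = (LINT r|lebesgue_on {0..<1}. r powr x * \<omega> r)"

definition bergman_kernel :: "(real \<Rightarrow> real) \<Rightarrow> complex \<Rightarrow> complex \<Rightarrow> complex" where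
  "bergman_kernel \<omega> z \<zeta> =
     (\<Sum>n. (cnj z * \<zeta>) ^ n / of_real (2 * moment \<omega> (2 * real n + 1)))"

definition bergman_integrand ::
    "(real \<Rightarrow> real) \<Rightarrow> (complex \<Rightarrow> complex) \<Rightarrow> complex \<Rightarrow> complex \<Rightarrow> complex" where
  "bergman_integrand \<omega> f z \<zeta> = f \<zeta> * cnj (bergman_kernel \<omega> z \<zeta>) * of_real (\<omega> (cmod \<zeta>))"

text \<open>The factor \<open>1 / \<pi>\<close> comes from the normalised area measure \<open>dA = dx dy / \<pi>\<close>.\<close>

definition bergman_projection ::
    "(real \<Rightarrow> real) \<Rightarrow> (complex \<Rightarrow> complex) \<Rightarrow> complex \<Rightarrow> complex" where
  "bergman_projection \<omega> f z =
     (LINT \<zeta>|lebesgue_on (ball 0 1). bergman_integrand \<omega> f z \<zeta>) / of_real pi"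

definition weighted_norm :: "(real \<Rightarrow> real) \<Rightarrow> (complex \<Rightarrow> complex) \<Rightarrow> ereal" where
  "weighted_norm \<nu> f =
     esssup (lebesgue_on (ball 0 1)) (\<lambda>z. ereal (cmod (f z) * tail \<nu> (cmod z)))"

definition L_inf :: "(real \<Rightarrow> real) \<Rightarrow> (complex \<Rightarrow> complex) set" where
  "L_inf \<nu> = {f \<in> borel_measurable (lebesgue_on (ball 0 1)). weighted_norm \<nu> f < \<infinity>}"

definition H_inf :: "(real \<Rightarrow> real) \<Rightarrow> (complex \<Rightarrow> complex) set" where
  "H_inf \<nu> = L_inf \<nu> \<inter> {f. f holomorphic_on ball 0 1}"

text \<open>
  Integrability of the integrand is required explicitly, because the Bochner integral of a
  non-integrable function is \<open>0\<close> by convention.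
\<close>

definition bergman_projection_bounded :: "(real \<Rightarrow> real) \<Rightarrow> (real \<Rightarrow> real) \<Rightarrow> bool" where
  "bergman_projection_bounded \<omega> \<nu> \<longleftrightarrow>
     (\<exists>C::real. \<forall>f\<in>L_inf \<nu>.
        (\<forall>z\<in>ball 0 1. integrable (lebesgue_on (ball 0 1)) (bergman_integrand \<omega> f z)) \<and>
        bergman_projection \<omega> f \<in> H_inf \<nu> \<and>
        weighted_norm \<nu> (bergman_projection \<omega> f) \<le> ereal C * weighted_norm \<nu> f)"

end

theory Submission
  imports Defs "HOL-Complex_Analysis.Cauchy_Integral_Formula"
begin

text \<open>
  Necessity. Suppose that the projection is bounded and test it on
  \<open>f(\<zeta>) = arg \<zeta> / \<nu>^(\<zeta>)\<close>, where \<open>\<nu>^\<close> is the tail integral of \<open>\<nu>\<close>. For \<open>n \<ge> 1\<close> the \<open>n\<close>-th Fourier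
  coefficient of the argument is \<open>\<i>/n\<close>, so for \<open>0 < x < 1\<close> the imaginary part of the projection at \<open>x\<close>
  is a series with nonnegative terms. Doubling of \<open>\<nu>^\<close> gives \<open>t^n \<nu>^(t) \<le> C \<nu>^(1 - 1/(n+1))\<close>, which
  bounds these terms from below by \<open>x^n / (C n \<nu>^(1 - 1/(n+1)))\<close>, whatever \<open>\<omega>\<close> is. Hence
  \<open>\<Sum>\<^sub>n x^n / (n \<nu>^(1 - 1/(n+1))) \<le> B / \<nu>^(r)\<close> for \<open>x < r\<close>; as the harmonic series diverges, the
  indices \<open>n\<close> between \<open>1/(1-r)\<close> and a large multiple of it force \<open>\<nu>^\<close> to drop by a factor.

  Sufficiency. Take \<open>\<omega>(t) = (1 - t^2)^a\<close>, whose kernel is \<open>(a+1) / (1 - w)^(a+2)\<close> with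
  \<open>w = \<zeta> cnj z\<close>. Bounding all but two of the factors \<open>1 / |1 - w|\<close> by \<open>1 / (1 - |w|)\<close> leaves the Poisson
  kernel, and the remaining radial integral, split at \<open>|z|\<close>, is controlled by the power decay of \<open>\<nu>^\<close> on
  the inside and by its doubling, for large \<open>a\<close>, on the outside.
\<close>

subsection \<open>Rotation averages and radial integrals\<close>

text \<open>The kernel of an arbitrary \<omega> admits no pointwise estimate, so necessity can only
  use its coefficients. The test function is radial apart from the argument. Hence the n-th
  coefficient of its projection is i/n times a quotient: the integral of |\<zeta>|^n \<omega> / tail
  over that of |\<zeta>|^(2n) \<omega>. Writing |\<zeta>|^(2n) as |\<zeta>|^n |\<zeta>|^n bounds
  this quotient from below with a constant free of \<omega>. The argument is bounded, its
  coefficients beyond the constant term all point in the direction of i, so nothing cancels, and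
  they decay slowly enough to have a divergent sum.

  In sufficiency the exponent \<open>a\<close> is the one with which the tail of \<nu> grows towards
  the origin: for t > |z| the factor (1 - t)^a then cancels the growth of the reciprocal tail
  exactly. For t < |z| monotonicity alone would leave the integral of 1/(1 - t), a logarithm; the
  positive decay exponent \<gamma> removes it. This logarithm is the continuous counterpart of the
  harmonic sum that drives necessity.\<close>

lemma measurable_Complex [measurable]: "(\<lambda>(x, y). Complex x y) \<in> borel_measurable (borel \<Otimes>\<^sub>M borel)"
proof -
  have "(\<lambda>p::real\<times>real. of_real (fst p) + \<i> * of_real (snd p)) \<in> borel_measurable (borel \<Otimes>\<^sub>M borel)"
    by measurable
  then show ?thesis by (simp add: case_prod_beta' Complex_eq)
qed

text \<open>Open boxes for the basis 1, i are rectangles, and Lebesgue measure is determined by its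
  values on them. This makes Fubini in real and imaginary part available.\<close>

lemma lborel_complex: "(lborel :: complex measure) = distr (lborel \<Otimes>\<^sub>M lborel) borel (\<lambda>(x, y). Complex x y)"
proof (rule lborel_eqI)
  fix l u :: complex
  assume le: "\<And>b. b \<in> Basis \<Longrightarrow> l \<bullet> b \<le> u \<bullet> b"
  from le[of 1] le[of \<i>] have le': "Re l \<le> Re u" "Im l \<le> Im u"
    by (auto simp: Basis_complex_def)
  have *: "(\<lambda>(x, y). Complex x y) -` box l u \<inter> space (lborel \<Otimes>\<^sub>M lborel) = {Re l<..<Re u} \<times> {Im l<..<Im u}"
    by (auto simp: box_def Basis_complex_def space_pair_measure)
  show "emeasure (distr (lborel \<Otimes>\<^sub>M lborel) borel (\<lambda>(x, y). Complex x y)) (box l u) = ennreal (\<Prod>b\<in>Basis. (u - l) \<bullet> b)"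
    using le' by (subst emeasure_distr) (auto simp: * lborel.emeasure_pair_measure_Times Basis_complex_def ennreal_mult
       complex_eq_iff)
qed simp

lemma nn_integral_lborel_complex:
  fixes F :: "complex \<Rightarrow> ennreal"
  assumes [measurable]: "F \<in> borel_measurable borel"
  shows "(\<integral>\<^sup>+z. F z \<partial>lborel) = (\<integral>\<^sup>+x. \<integral>\<^sup>+y. F (Complex x y) \<partial>lborel \<partial>lborel)"
    and "(\<integral>\<^sup>+z. F z \<partial>lborel) = (\<integral>\<^sup>+y. \<integral>\<^sup>+x. F (Complex x y) \<partial>lborel \<partial>lborel)"
proof -
  have [measurable]: "(\<lambda>(x,y). F (Complex x y)) \<in> borel_measurable (borel \<Otimes>\<^sub>M borel)"
    using measurable_compose[OF measurable_Complex assms] by (simp add: case_prod_beta')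
  show 1: "(\<integral>\<^sup>+z. F z \<partial>lborel) = (\<integral>\<^sup>+x. \<integral>\<^sup>+y. F (Complex x y) \<partial>lborel \<partial>lborel)"
    by (subst lborel_complex)
       (simp add: nn_integral_distr lborel.nn_integral_fst[symmetric] case_prod_beta')
  show "(\<integral>\<^sup>+z. F z \<partial>lborel) = (\<integral>\<^sup>+y. \<integral>\<^sup>+x. F (Complex x y) \<partial>lborel \<partial>lborel)"
    unfolding 1 by (rule lborel_pair.Fubini') measurable
qed

text \<open>With the other coordinate fixed, a shear is a translation of the line, so the inner
  integral does not change. The two directions use the two orders of integration.\<close>

lemma nn_integral_shear:
  fixes F :: "complex \<Rightarrow> ennreal"
  assumes [measurable]: "F \<in> borel_measurable borel"
  shows "(\<integral>\<^sup>+z. F (Complex (Re z + a * Im z) (Im z)) \<partial>lborel) = (\<integral>\<^sup>+z. F z \<partial>lborel)"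
    and "(\<integral>\<^sup>+z. F (Complex (Re z) (Im z + a * Re z)) \<partial>lborel) = (\<integral>\<^sup>+z. F z \<partial>lborel)"
proof -
  have m: "(\<lambda>z. Complex (f z) (g z)) \<in> borel_measurable M"
    if [measurable]: "f \<in> borel_measurable M" "g \<in> borel_measurable M" for f g and M :: "'b measure"
    unfolding Complex_eq by measurable
  note [measurable] = measurable_compose[OF m assms]
  have *: "(\<integral>\<^sup>+y. G (y + t) \<partial>lborel) = (\<integral>\<^sup>+y. G y \<partial>lborel)"
    if [measurable]: "G \<in> borel_measurable borel" for G :: "real \<Rightarrow> ennreal" and t
    using nn_integral_real_affine[of G 1 t] that by (simp add: add.commute)
  show "(\<integral>\<^sup>+z. F (Complex (Re z + a * Im z) (Im z)) \<partial>lborel) = (\<integral>\<^sup>+z. F z \<partial>lborel)"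
    by (subst (1 2) nn_integral_lborel_complex(2))
       (auto intro!: nn_integral_cong *[of "\<lambda>x. F (Complex x y)" "a*y" for y])
  show "(\<integral>\<^sup>+z. F (Complex (Re z) (Im z + a * Re z)) \<partial>lborel) = (\<integral>\<^sup>+z. F z \<partial>lborel)"
    by (subst (1 2) nn_integral_lborel_complex(1))
       (auto intro!: nn_integral_cong *[of "\<lambda>x. F (Complex y x)" "a*y" for y])
qed

text \<open>A rotation other than the half turn is a product of three shears.\<close>

lemma nn_integral_rotation:
  fixes F :: "complex \<Rightarrow> ennreal"
  assumes [measurable]: "F \<in> borel_measurable borel" and c: "cmod c = 1"
  shows "(\<integral>\<^sup>+z. F (c * z) \<partial>lborel) = (\<integral>\<^sup>+z. F z \<partial>lborel)"
proof -
  have *: "(\<integral>\<^sup>+z. F (c * z) \<partial>lborel) = (\<integral>\<^sup>+z. F z \<partial>lborel)"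
    if c: "cmod c = 1" "c \<noteq> -1" and [measurable]: "F \<in> borel_measurable borel" for c and F :: "complex \<Rightarrow> ennreal"
  proof -
    have r: "(Re c)^2 + (Im c)^2 = 1"
      using c(1) by (metis cmod_power2 one_power2)
    have "Re c \<noteq> -1"
      using r c(2) by (auto simp: complex_eq_iff)
    then have nz: "1 + Re c \<noteq> 0" by linarith
    \<comment> \<open>For c = exp(i \<phi>) this is - tan(\<phi>/2), the coefficient of the outer
      shears; the middle one has coefficient sin \<phi>. The tangent is infinite exactly at the half
      turn.\<close>
    define a where "a = - Im c / (1 + Re c)"
    have aI: "1 + a * Im c = Re c"
      using nz r by (simp add: a_def field_simps power2_eq_square)
    have "a + Re c * a = (1 + Re c) * a" by (simp add: algebra_simps)
    then have aR: "a + Re c * a = - Im c"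
      using nz by (simp add: a_def)
    define S where "S = (\<lambda>z. Complex (Re z + a * Im z) (Im z))"
    define T where "T = (\<lambda>z. Complex (Re z) (Im z + Im c * Re z))"
    have [measurable]: "S \<in> borel_measurable borel" "T \<in> borel_measurable borel"
      unfolding S_def T_def Complex_eq by measurable
    have eq: "c * z = S (T (S z))" for z
    proof (rule complex_eqI)
      have "Re (S (T (S z))) = (1 + a * Im c) * Re z + (a + (1 + a * Im c) * a) * Im z"
        by (simp add: S_def T_def algebra_simps)
      then show "Re (c * z) = Re (S (T (S z)))"
        unfolding aI aR by simp
      have "Im (S (T (S z))) = Im c * Re z + (1 + a * Im c) * Im z"
        by (simp add: S_def T_def algebra_simps)
      then show "Im (c * z) = Im (S (T (S z)))"
        unfolding aI by simp
    qed
    have "(\<integral>\<^sup>+z. F (S (T (S z))) \<partial>lborel) = (\<integral>\<^sup>+z. F (S (T z)) \<partial>lborel)"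
      using nn_integral_shear(1)[of "\<lambda>z. F (S (T z))" a] by (simp add: S_def)
    also have "\<dots> = (\<integral>\<^sup>+z. F (S z) \<partial>lborel)"
      using nn_integral_shear(2)[of "\<lambda>z. F (S z)" "Im c"] by (simp add: T_def)
    also have "\<dots> = (\<integral>\<^sup>+z. F z \<partial>lborel)"
      using nn_integral_shear(1)[of F a] by (simp add: S_def)
    finally show ?thesis by (simp add: eq)
  qed
  show ?thesis
  proof (cases "c = -1")
    \<comment> \<open>The half turn is two quarter turns.\<close>
    case True
    have "(\<integral>\<^sup>+z. F (\<i> * (\<i> * z)) \<partial>lborel) = (\<integral>\<^sup>+z. F (\<i> * z) \<partial>lborel)"
      by (rule *[of \<i> "\<lambda>z. F (\<i> * z)"]) (auto simp: complex_eq_iff)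
    also have "\<dots> = (\<integral>\<^sup>+z. F z \<partial>lborel)"
      by (rule *[of \<i> F]) (auto simp: complex_eq_iff)
    finally show ?thesis using True by simp
  next
    case False then show ?thesis using * c by auto
  qed
qed

lemma distr_lborel_rotation:
  assumes "cmod c = 1" shows "distr lborel borel ((*) c) = (lborel :: complex measure)"
proof (rule measure_eqI)
  fix X assume "X \<in> sets (distr lborel borel ((*) c))"
  then have [measurable]: "X \<in> sets borel" by simp
  have "emeasure (distr lborel borel ((*) c)) X = (\<integral>\<^sup>+z. indicator X z \<partial>distr lborel borel ((*) c))"
    by simp
  also have "\<dots> = (\<integral>\<^sup>+z. indicator X (c * z) \<partial>lborel)"
    by (subst nn_integral_distr) auto
  also have "\<dots> = emeasure lborel X"
    by (subst nn_integral_rotation[OF _ assms]) auto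
  finally show "emeasure (distr lborel borel ((*) c)) X = emeasure lborel X" .
qed simp

section \<open>Averages over circles in place of polar coordinates\<close>

lemma measurable_cis [measurable]: "cis \<in> borel_measurable borel"
  by (intro borel_measurable_continuous_onI continuous_intros)

text \<open>Tonelli and rotation invariance. An integrand may thus be replaced by its integrals over
  circles about 0, at the price of the factor 2 \<pi>; the angular part is then computed pointwise
  in z.\<close>

lemma nn_integral_circle_average:
  fixes F :: "complex \<Rightarrow> ennreal"
  assumes [measurable]: "F \<in> borel_measurable borel"
  shows "(\<integral>\<^sup>+z. (\<integral>\<^sup>+\<theta>\<in>{0..2*pi}. F (cis \<theta> * z) \<partial>lborel) \<partial>lborel) = ennreal (2*pi) * (\<integral>\<^sup>+z. F z \<partial>lborel)"
proof -
  have "(\<integral>\<^sup>+z. (\<integral>\<^sup>+\<theta>\<in>{0..2*pi}. F (cis \<theta> * z) \<partial>lborel) \<partial>lborel) =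
        (\<integral>\<^sup>+\<theta>. (\<integral>\<^sup>+z. F (cis \<theta> * z) * indicator {0..2*pi} \<theta> \<partial>lborel) \<partial>lborel)"
    by (rule lborel_pair.Fubini') measurable
  also have "\<dots> = (\<integral>\<^sup>+\<theta>. (\<integral>\<^sup>+z. F z \<partial>lborel) * indicator {0..2*pi} \<theta> \<partial>lborel)"
    by (intro nn_integral_cong) (simp add: nn_integral_multc nn_integral_rotation)
  also have "\<dots> = ennreal (2*pi) * (\<integral>\<^sup>+z. F z \<partial>lborel)"
    by (simp add: nn_integral_cmult_indicator mult.commute)
  finally show ?thesis .
qed

text \<open>The signed counterpart. Fubini needs integrability on the product, which follows from
  Tonelli applied to the norm, since every rotation of \<open>F\<close> has the same norm
  integral.\<close>

lemma integral_circle_average: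
  fixes F :: "complex \<Rightarrow> complex"
  assumes int: "integrable lborel F"
  shows "(LINT z|lborel. (LINT \<theta>:{0..2*pi}|lborel. F (cis \<theta> * z))) = 2 * pi * (LINT z|lborel. F z)"
proof -
  from int have [measurable]: "F \<in> borel_measurable borel" by auto
  let ?G = "\<lambda>\<theta> z. indicator {0..2*pi} \<theta> *\<^sub>R F (cis \<theta> * z)"
  have rot: "integrable lborel (\<lambda>z. F (c * z))" "(LINT z|lborel. F (c * z)) = (LINT z|lborel. F z)" if "cmod c = 1" for c
  proof -
    have "integrable (distr lborel borel ((*) c)) F" using int by (simp add: distr_lborel_rotation that)
    then show "integrable lborel (\<lambda>z. F (c * z))" by (subst (asm) integrable_distr_eq) auto
    have "(LINT z|lborel. F z) = (LINT z|distr lborel borel ((*) c). F z)" by (simp add: distr_lborel_rotation that)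
    also have "\<dots> = (LINT z|lborel. F (c * z))" by (subst integral_distr) auto
    finally show "(LINT z|lborel. F (c * z)) = (LINT z|lborel. F z)" ..
  qed
  have "integrable (lborel \<Otimes>\<^sub>M lborel) (case_prod ?G)"
  proof (rule integrableI_bounded)
    show "case_prod ?G \<in> borel_measurable (lborel \<Otimes>\<^sub>M lborel)" by measurable
    have "(\<integral>\<^sup>+p. ennreal (norm (case_prod ?G p)) \<partial>(lborel \<Otimes>\<^sub>M lborel)) =
       (\<integral>\<^sup>+\<theta>. (\<integral>\<^sup>+z. ennreal (norm (?G \<theta> z)) \<partial>lborel) \<partial>lborel)"
      by (subst lborel.nn_integral_fst[symmetric]) auto
    also have "\<dots> = (\<integral>\<^sup>+\<theta>. (\<integral>\<^sup>+z. ennreal (norm (F (cis \<theta> * z))) * indicator {0..2*pi} \<theta> \<partial>lborel) \<partial>lborel)"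
      by (intro nn_integral_cong) (auto simp: indicator_def)
    also have "\<dots> = (\<integral>\<^sup>+\<theta>. (\<integral>\<^sup>+z. norm (F z) \<partial>lborel) * indicator {0..2*pi} \<theta> \<partial>lborel)"
      by (intro nn_integral_cong) (simp add: nn_integral_multc nn_integral_rotation[of "\<lambda>z. ennreal (norm (F z))"])
    also have "\<dots> < \<infinity>"
      using int by (auto simp: nn_integral_cmult_indicator integrable_iff_bounded ennreal_mult_less_top)
    finally show "(\<integral>\<^sup>+p. ennreal (norm (case_prod ?G p)) \<partial>(lborel \<Otimes>\<^sub>M lborel)) < \<infinity>" .
  qed
  then have "(LINT z|lborel. (LINT \<theta>|lborel. ?G \<theta> z)) = (LINT \<theta>|lborel. (LINT z|lborel. ?G \<theta> z))"
    by (rule lborel_pair.Fubini_integral)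
  also have "\<dots> = (LINT \<theta>|lborel. indicator {0..2*pi} \<theta> *\<^sub>R (LINT z|lborel. F z))"
    by (intro Bochner_Integration.integral_cong) (simp_all add: rot)
  also have "\<dots> = 2 * pi * (LINT z|lborel. F z)"
    by (simp add: scaleR_conv_of_real)
  finally show ?thesis by (simp add: set_lebesgue_integral_def)
qed

text \<open>The image of area on the disc under \<open>cmod\<close> and the density 2 \<pi> t on
  [0,1) are measures on the line that agree, with finite values, on every ray (x, \<infinity>): for
  0 \<le> x < 1 both give the annulus area \<pi> (1 - x^2).\<close>

lemma nn_integral_disc_radial:
  fixes g :: "real \<Rightarrow> ennreal"
  assumes [measurable]: "g \<in> borel_measurable borel"
  shows "(\<integral>\<^sup>+z\<in>ball (0::complex) 1. g (cmod z) \<partial>lborel) = (\<integral>\<^sup>+t\<in>{0..<1}. ennreal (2*pi*t) * g t \<partial>lborel)"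
proof -
  let ?M = "distr (density lborel (indicator (ball (0::complex) 1))) borel cmod"
  let ?N = "density lborel (\<lambda>t. ennreal (2*pi*t) * indicator {0..<1} t)"
  have [measurable]: "ball (0::complex) 1 \<in> sets borel" "cmod -` {x<..} \<in> sets borel" for x
    using measurable_sets_borel[of cmod borel "{x<..}"] by auto
  have M: "emeasure ?M {x<..} = (if x < 0 then ennreal pi else if x < 1 then ennreal (pi * (1 - x^2)) else 0)" for x
  proof -
    have "emeasure ?M {x<..} = emeasure (density lborel (indicator (ball (0::complex) 1))) (cmod -` {x<..})"
      by (subst emeasure_distr) auto
    also have "\<dots> = emeasure lborel (ball (0::complex) 1 \<inter> cmod -` {x<..})"
      by (subst emeasure_density) (simp_all add: indicator_inter_arith[symmetric])
    also have "\<dots> = (if x < 0 then ennreal pi else if x < 1 then ennreal (pi * (1 - x^2)) else 0)"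
    proof -
      consider "x < 0" | "0 \<le> x" "x < 1" | "1 \<le> x" by linarith
      then show ?thesis
      proof cases
        case 1
        then have "ball (0::complex) 1 \<inter> cmod -` {x<..} = ball 0 1"
          by (auto intro: less_le_trans[OF _ norm_ge_zero])
        then show ?thesis using 1 by (simp add: emeasure_ball unit_ball_vol_2 DIM_complex)
      next
        case 2
        have "ball (0::complex) 1 \<inter> cmod -` {x<..} = ball 0 1 - cball 0 x" by auto
        also have "emeasure lborel \<dots> = emeasure lborel (ball (0::complex) 1) - emeasure lborel (cball (0::complex) x)"
          by (rule emeasure_Diff) (use 2 in \<open>auto simp: emeasure_cball\<close>)
        also have "\<dots> = ennreal (pi * (1 - x^2))"
          using 2 by (simp add: emeasure_ball emeasure_cball unit_ball_vol_2 DIM_complex ennreal_minus algebra_simps)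
        finally show ?thesis using 2 by simp
      next
        case 3
        then have "ball (0::complex) 1 \<inter> cmod -` {x<..} = {}" by auto
        then show ?thesis using 3 by simp
      qed
    qed
    finally show ?thesis .
  qed
  have N: "emeasure ?N {x<..} = (if x < 0 then ennreal pi else if x < 1 then ennreal (pi * (1 - x^2)) else 0)" for x
  proof -
    have ftc: "(\<integral>\<^sup>+t. ennreal (2*pi*t) * indicator {x..1} t \<partial>lborel) = ennreal (pi * (1 - x^2))" if "0 \<le> x" "x \<le> 1" for x
      using that by (subst nn_integral_FTC_Icc[where F="\<lambda>t. pi * t^2"])
         (auto intro!: derivative_eq_intros simp: algebra_simps)
    have "emeasure ?N {x<..} = (\<integral>\<^sup>+t. ennreal (2*pi*t) * indicator {0..<1} t * indicator {x<..} t \<partial>lborel)"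
      by (subst emeasure_density) auto
    also have "\<dots> = (\<integral>\<^sup>+t. ennreal (2*pi*t) * indicator {max 0 x..1} t \<partial>lborel)"
      by (rule nn_integral_cong_AE, use AE_lborel_singleton[of x] AE_lborel_singleton[of "1::real"] in eventually_elim)
         (auto simp: indicator_def)
    also have "\<dots> = (if x < 0 then ennreal pi else if x < 1 then ennreal (pi * (1 - x^2)) else 0)"
    proof (cases "x < 1")
      case True then show ?thesis using ftc[of "max 0 x"] by (auto simp: max_def)
    next
      case False
      have "AE t in lborel. ennreal (2*pi*t) * indicator {max 0 x..1} t = 0"
        using AE_lborel_singleton[of "1::real"] by eventually_elim (use False in \<open>auto simp: indicator_def\<close>)
      then have "(\<integral>\<^sup>+t. ennreal (2*pi*t) * indicator {max 0 x..1} t \<partial>lborel) = (\<integral>\<^sup>+(t::real). 0 \<partial>lborel)"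
        by (rule nn_integral_cong_AE)
      then show ?thesis using False by simp
    qed
    finally show ?thesis .
  qed
  have eq: "?M = ?N"
    by (rule measure_eqI_lessThan) (simp_all only: M N, auto)
  have "(\<integral>\<^sup>+z\<in>ball (0::complex) 1. g (cmod z) \<partial>lborel) = (\<integral>\<^sup>+t. g t \<partial>?M)"
    by (subst nn_integral_distr) (auto simp: nn_integral_density mult.commute)
  also have "\<dots> = (\<integral>\<^sup>+t\<in>{0..<1}. ennreal (2*pi*t) * g t \<partial>lborel)"
    unfolding eq by (subst nn_integral_density) (auto intro!: nn_integral_cong simp: mult_ac)
  finally show ?thesis .
qed

subsection \<open>Radial weights and the kernel series\<close>

lemma tail_pos: "radial_weight \<omega> \<Longrightarrow> 0 \<le> r \<Longrightarrow> r < 1 \<Longrightarrow> 0 < tail \<omega> r"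
  unfolding radial_weight_def by (auto dest!: bspec[where x="of_real r"])

lemma tail_antimono:
  assumes "radial_weight \<omega>" "0 \<le> r" "r \<le> t"
  shows "tail \<omega> t \<le> tail \<omega> r"
proof -
  have "integrable lebesgue (\<lambda>s. indicator {0..<1} s *\<^sub>R \<omega> s)"
    using assms(1) unfolding radial_weight_def by (subst (asm) integrable_restrict_space) auto
  note int = integrable_mult_indicator[OF _ this]
  have *: "tail \<omega> x = (LINT s|lebesgue. indicator {x..<1} s *\<^sub>R \<omega> s)" for x
    unfolding tail_def by (subst integral_restrict_space) auto
  have "integrable lebesgue (\<lambda>s. indicator {x..<1} s *\<^sub>R \<omega> s)" if "0 \<le> x" for x
    by (rule Bochner_Integration.integrable_cong[THEN iffD1, OF refl _ int[of "{x..<1}"]])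
       (use that in \<open>auto simp: indicator_def\<close>)
  then show ?thesis unfolding * using assms
    by (intro integral_mono) (auto simp: indicator_def radial_weight_def)
qed

lemma tail_nonneg: "radial_weight \<omega> \<Longrightarrow> 0 \<le> r \<Longrightarrow> 0 \<le> tail \<omega> r"
  using tail_pos[of \<omega> r] by (cases "r < 1") (auto simp: tail_def integral_restrict_space)

text \<open>A monotone function is Borel. The tail is only known to decrease on [0, \<infinity>), as
  a profile is arbitrary at negative arguments; \<open>max 0\<close> extends the monotonicity to the
  whole line.\<close>

lemma measurable_tail_norm [measurable]:
  assumes "radial_weight \<omega>" shows "(\<lambda>z::complex. tail \<omega> (cmod z)) \<in> borel_measurable borel"
proof -
  have "mono (\<lambda>t. - tail \<omega> (max 0 t))"
    by (intro monoI) (use assms in \<open>auto intro!: tail_antimono\<close>)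
  then have "(\<lambda>t. - tail \<omega> (max 0 t)) \<in> borel_measurable borel"
    by (rule borel_measurable_mono)
  then have "(\<lambda>t. - (- tail \<omega> (max 0 t))) \<in> borel_measurable borel"
    by (rule borel_measurable_uminus)
  then have "(\<lambda>z::complex. - (- tail \<omega> (max 0 (cmod z)))) \<in> borel_measurable borel"
    by measurable
  then show ?thesis by simp
qed

lemma measurable_tail_max [measurable]:
  assumes "radial_weight \<omega>" shows "(\<lambda>t. tail \<omega> (max 0 t)) \<in> borel_measurable borel"
proof -
  have "(\<lambda>t. tail \<omega> (cmod (of_real (max 0 t)))) \<in> borel_measurable borel"
    using measurable_tail_norm[OF assms] by measurable
  then show ?thesis by simp
qed

text \<open>A weight is only Lebesgue measurable, whereas the circle averages are stated for Borel
  functions on the whole plane. Hence the Borel representative that vanishes off [0,1).\<close>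

lemma radial_weight_borel:
  assumes "radial_weight \<omega>"
  obtains w where "w \<in> borel_measurable borel" "\<And>t. 0 \<le> w t" "\<And>t. t \<notin> {0..<1} \<Longrightarrow> w t = 0"
    "integrable lborel w" "AE t in lborel. t \<in> {0..<1} \<longrightarrow> \<omega> t = w t"
proof -
  have int: "integrable lebesgue (\<lambda>s. indicator {0..<1} s *\<^sub>R \<omega> s)"
    using assms unfolding radial_weight_def by (subst (asm) integrable_restrict_space) auto
  then obtain g where [measurable]: "g \<in> borel_measurable lborel" and g: "AE s in lborel. indicator {0..<1} s *\<^sub>R \<omega> s = g s"
    using completion_ex_borel_measurable_real[OF borel_measurable_integrable[OF int]] by auto
  define w where "w = (\<lambda>t. max 0 (g t) * indicator {0..<1::real} t)"
  have [measurable]: "w \<in> borel_measurable borel" unfolding w_def by measurable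
  have ae: "AE s in lborel. indicator {0..<1} s *\<^sub>R \<omega> s = w s"
    using g
  proof eventually_elim
    case (elim s)
    show ?case
    proof (cases "s \<in> {0..<1}")
      case True
      then have "0 \<le> \<omega> s" using assms by (auto simp: radial_weight_def)
      with elim True show ?thesis by (simp add: w_def)
    qed (simp add: w_def)
  qed
  show ?thesis
  proof (rule that)
    show "integrable lborel w"
    proof -
      have "integrable lebesgue w"
        by (rule integrable_cong_AE_imp[OF int]) (use ae in \<open>auto intro!: AE_completion measurable_completion elim: eventually_mono\<close>)
      then show ?thesis by (simp add: integrable_completion)
    qed
    show "AE t in lborel. t \<in> {0..<1} \<longrightarrow> \<omega> t = w t" using ae by eventually_elim auto
  qed (auto simp: w_def)
qed

text \<open>Discard [0, \<rho>) and use r^x \<ge> \<rho>^x on the rest. As \<rho> may be close to 1,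
  the moments decay more slowly than any geometric sequence, which is what makes the kernel series
  converge.\<close>

lemma moment_ge:
  assumes "radial_weight \<omega>" "0 < \<rho>" "\<rho> < 1" "0 \<le> x"
  shows "\<rho> powr x * tail \<omega> \<rho> \<le> moment \<omega> x"
proof -
  have int: "integrable (lebesgue_on {0..<1}) \<omega>" using assms by (simp add: radial_weight_def)
  have int2: "integrable (lebesgue_on {0..<1}) (\<lambda>r. r powr x * \<omega> r)"
  proof (rule Bochner_Integration.integrable_bound[OF int])
    have "(\<lambda>r. r powr x) \<in> borel_measurable (lebesgue_on {0..<1})"
      by (intro measurable_restrict_space1 measurable_completion) simp
    then show "(\<lambda>r. r powr x * \<omega> r) \<in> borel_measurable (lebesgue_on {0..<1})"
      using int by (auto intro: borel_measurable_times)
    have "r powr x * \<omega> r \<le> 1 * \<omega> r" if "0 \<le> r" "r < 1" for r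
      using assms that by (intro mult_right_mono) (auto simp: radial_weight_def intro!: powr_le1)
    then show "AE r in lebesgue_on {0..<1}. norm (r powr x * \<omega> r) \<le> norm (\<omega> r)"
      using assms by (auto simp: abs_mult radial_weight_def intro!: AE_I2)
  qed
  have int3: "integrable (lebesgue_on {0..<1}) (\<lambda>r. indicator {\<rho>..<1} r *\<^sub>R (\<rho> powr x * \<omega> r))"
    by (intro integrable_mult_indicator integrable_mult_right int) (use assms in \<open>auto simp: sets_restrict_space_iff\<close>)
  have "\<rho> powr x * tail \<omega> \<rho> = (LINT r|lebesgue_on {\<rho>..<1}. \<rho> powr x * \<omega> r)"
    by (simp add: tail_def)
  also have "\<dots> = (LINT r|lebesgue_on {0..<1}. indicator {\<rho>..<1} r *\<^sub>R (\<rho> powr x * \<omega> r))"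
    by (subst (1 2) integral_restrict_space) (use assms in \<open>auto intro!: Bochner_Integration.integral_cong simp: indicator_def\<close>)
  also have "\<dots> \<le> moment \<omega> x"
    unfolding moment_def using int3 int2
    by (rule integral_mono)
       (use assms in \<open>auto simp: radial_weight_def indicator_def intro!: mult_right_mono powr_mono2\<close>)
  finally show ?thesis .
qed

lemma moment_pos: "radial_weight \<omega> \<Longrightarrow> 0 \<le> x \<Longrightarrow> 0 < moment \<omega> x"
  by (rule less_le_trans[OF _ moment_ge[of \<omega> "1/2" x]]) (auto intro!: mult_pos_pos tail_pos)

lemma summable_moment:
  assumes "radial_weight \<omega>" "0 \<le> x" "x < 1"
  shows "summable (\<lambda>n. x ^ n / (2 * moment \<omega> (2 * real n + 1)))"
proof -
  \<comment> \<open>Chosen so that x < \<rho>^2 < 1: the terms are then dominated by a geometric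
    series of ratio x / \<rho>^2.\<close>
  define \<rho> where "\<rho> = sqrt ((1 + x) / 2)"
  have \<rho>: "0 < \<rho>" "\<rho> < 1" and \<rho>2: "\<rho>\<^sup>2 = (1 + x) / 2" using assms by (auto simp: \<rho>_def)
  have t: "0 < tail \<omega> \<rho>" using tail_pos[OF assms(1)] \<rho> by simp
  have "summable (\<lambda>n. 1 / (2 * \<rho> * tail \<omega> \<rho>) * (x / \<rho>\<^sup>2) ^ n)"
    by (intro summable_mult summable_geometric) (use assms in \<open>auto simp: \<rho>2\<close>)
  then show ?thesis
  proof (rule summable_comparison_test[rotated], intro exI[of _ 0] allI impI)
    fix n
    have "\<rho> powr (2 * real n + 1) = (\<rho>\<^sup>2)^n * \<rho>"
      using \<rho> powr_realpow[of \<rho> "2*n+1"] by (simp add: power_mult[symmetric] add_ac mult.commute)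
    then have le: "(\<rho>\<^sup>2)^n * \<rho> * tail \<omega> \<rho> \<le> moment \<omega> (2 * real n + 1)"
      using moment_ge[OF assms(1) \<rho>, of "2 * real n + 1"] by simp
    have "x ^ n / (2 * moment \<omega> (2 * real n + 1)) \<le> x ^ n / (2 * ((\<rho>\<^sup>2)^n * \<rho> * tail \<omega> \<rho>))"
      using le \<rho> t assms by (intro divide_left_mono mult_pos_pos) (auto simp: moment_pos)
    also have "\<dots> = 1 / (2 * \<rho> * tail \<omega> \<rho>) * (x / \<rho>\<^sup>2) ^ n"
      using \<rho> t by (simp add: power_divide field_simps)
    finally show "norm (x ^ n / (2 * moment \<omega> (2 * real n + 1))) \<le> 1 / (2 * \<rho> * tail \<omega> \<rho>) * (x / \<rho>\<^sup>2) ^ n"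
      using moment_pos[OF assms(1), of "2 * real n + 1"] assms by simp
  qed
qed

text \<open>Termwise integration: the terms are dominated by |g| |a n| |z|^n, whose integrals are
  summable. With \<open>p\<close> = \<open>cnj\<close> it turns the projection into a power series
  in z.\<close>

lemma integral_power_series:
  fixes g p :: "'a \<Rightarrow> complex" and a :: "nat \<Rightarrow> complex"
  assumes g: "integrable M g" and [measurable]: "p \<in> borel_measurable M"
    and p: "\<And>x. x \<in> space M \<Longrightarrow> cmod (p x) \<le> 1"
    and sm: "summable (\<lambda>n. cmod (a n) * cmod z ^ n)"
  shows "integrable M (\<lambda>x. g x * (\<Sum>n. a n * (z * p x) ^ n))"
    and "(\<lambda>n. a n * z ^ n * (LINT x|M. g x * p x ^ n)) sums (LINT x|M. g x * (\<Sum>n. a n * (z * p x) ^ n))"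
proof -
  have [measurable]: "g \<in> borel_measurable M" using g by auto
  let ?f = "\<lambda>n x. g x * (a n * (z * p x) ^ n)"
  have le: "norm (?f n x) \<le> cmod (g x) * (cmod (a n) * cmod z ^ n)" if "x \<in> space M" for n x
  proof -
    have "cmod (p x) ^ n \<le> 1" using p[OF that] by (simp add: power_le_one)
    then have "cmod (z * p x) ^ n \<le> cmod z ^ n * 1" unfolding norm_mult power_mult_distrib
      by (intro mult_left_mono) auto
    then show ?thesis by (simp add: norm_mult norm_power mult_left_mono power_mult_distrib)
  qed
  have f: "integrable M (?f n)" for n
    by (rule Bochner_Integration.integrable_bound[OF integrable_mult_left[OF integrable_norm[OF g], of "cmod (a n) * cmod z ^ n"]])
       (use le in \<open>auto simp: abs_mult\<close>)
  have s: "summable (\<lambda>n. norm (?f n x))" if "x \<in> space M" for x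
    by (rule summable_comparison_test'[OF summable_mult[OF sm, of "cmod (g x)"], of 0]) (use le[OF that] in auto)
  have s': "summable (\<lambda>n. a n * (z * p x) ^ n)" if "x \<in> space M" for x
    by (rule summable_comparison_test'[OF sm, of 0])
       (use p[OF that] in \<open>auto simp: norm_mult norm_power power_mult_distrib mult_left_le power_le_one intro!: mult_left_mono\<close>)
  have i: "summable (\<lambda>n. (LINT x|M. norm (?f n x)))"
  proof (rule summable_comparison_test'[OF summable_mult[OF sm, of "LINT x|M. cmod (g x)"], of 0])
    fix n
    have "(LINT x|M. norm (?f n x)) \<le> (LINT x|M. cmod (g x) * (cmod (a n) * cmod z ^ n))"
      by (rule integral_mono) (use f g le in auto)
    also have "\<dots> = (LINT x|M. cmod (g x)) * (cmod (a n) * cmod z ^ n)" by simp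
    finally show "norm (LINT x|M. norm (?f n x)) \<le> (LINT x|M. cmod (g x)) * (cmod (a n) * cmod z ^ n)"
      by (simp add: Bochner_Integration.integral_nonneg)
  qed
  have eq: "(\<Sum>n. ?f n x) = g x * (\<Sum>n. a n * (z * p x) ^ n)" if "x \<in> space M" for x
    using suminf_mult[OF s'[OF that], of "g x"] by simp
  have "integrable M (\<lambda>x. (\<Sum>n. ?f n x))"
    by (rule integrable_suminf[OF f _ i]) (use s in auto)
  then show "integrable M (\<lambda>x. g x * (\<Sum>n. a n * (z * p x) ^ n))"
    by (simp add: eq cong: Bochner_Integration.integrable_cong)
  have "(\<lambda>n. LINT x|M. ?f n x) sums (LINT x|M. (\<Sum>n. ?f n x))"
    by (rule sums_integral[OF f _ i]) (use s in auto)
  also have "(LINT x|M. (\<Sum>n. ?f n x)) = (LINT x|M. g x * (\<Sum>n. a n * (z * p x) ^ n))"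
    by (intro Bochner_Integration.integral_cong) (auto simp: eq)
  also have "(\<lambda>n. LINT x|M. ?f n x) = (\<lambda>n. a n * z ^ n * (LINT x|M. g x * p x ^ n))"
    by (simp add: power_mult_distrib mult_ac flip: integral_mult_right_zero)
  finally show "(\<lambda>n. a n * z ^ n * (LINT x|M. g x * p x ^ n)) sums (LINT x|M. g x * (\<Sum>n. a n * (z * p x) ^ n))" .
qed

lemma measurable_lebesgue_on_borel: "f \<in> borel_measurable borel \<Longrightarrow> f \<in> borel_measurable (lebesgue_on S)"
  by (intro measurable_restrict_space1 measurable_completion) simp

text \<open>For fixed z the kernel is a series converging uniformly in \<zeta>, so integrability of
  f \<omega> is all that is required. The Taylor coefficients of the projection pair f \<omega> with
  the conjugate powers of \<zeta>.\<close>

lemma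
  fixes f :: "complex \<Rightarrow> complex"
  assumes w: "radial_weight \<omega>"
    and int: "integrable (lebesgue_on (ball 0 1)) (\<lambda>\<zeta>. f \<zeta> * \<omega> (cmod \<zeta>))"
    and z: "z \<in> ball 0 1"
  shows integrable_bergman_integrand: "integrable (lebesgue_on (ball 0 1)) (bergman_integrand \<omega> f z)"
    and bergman_projection_sums:
     "(\<lambda>n. (LINT \<zeta>|lebesgue_on (ball 0 1). f \<zeta> * \<omega> (cmod \<zeta>) * cnj \<zeta> ^ n) / (2 * pi * moment \<omega> (2 * real n + 1)) * z ^ n)
        sums bergman_projection \<omega> f z"
proof -
  define a :: "nat \<Rightarrow> complex" where "a n = 1 / (2 * moment \<omega> (2 * real n + 1))" for n
  have sm: "summable (\<lambda>n. cmod (a n) * x ^ n)" if "0 \<le> x" "x < 1" for x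
    using summable_moment[OF w that] by (simp add: a_def norm_divide norm_mult moment_pos[OF w] abs_of_pos)
  note smz = sm[of "cmod z"]
  have ker: "cnj (bergman_kernel \<omega> z \<zeta>) = (\<Sum>n. a n * (z * cnj \<zeta>) ^ n)" if "\<zeta> \<in> ball 0 1" for \<zeta>
  proof -
    have "cmod z * cmod \<zeta> < 1" using z that mult_strict_mono'[of "cmod z" 1 "cmod \<zeta>" 1] by auto
    then have "summable (\<lambda>n. cnj (a n) * (cnj z * \<zeta>) ^ n)"
      by (intro summable_norm_cancel[OF summable_cong[THEN iffD1, OF _ sm[of "cmod z * cmod \<zeta>"]]])
         (auto simp: norm_mult norm_power a_def norm_divide)
    then have "(\<lambda>n. cnj (cnj (a n) * (cnj z * \<zeta>) ^ n)) sums cnj (\<Sum>n. cnj (a n) * (cnj z * \<zeta>) ^ n)"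
      by (simp only: sums_cnj summable_sums)
    then have "cnj (\<Sum>n. cnj (a n) * (cnj z * \<zeta>) ^ n) = (\<Sum>n. a n * (z * cnj \<zeta>) ^ n)"
      by (simp add: sums_iff)
    then show ?thesis by (simp add: bergman_kernel_def a_def)
  qed
  have eq: "bergman_integrand \<omega> f z \<zeta> = f \<zeta> * \<omega> (cmod \<zeta>) * (\<Sum>n. a n * (z * cnj \<zeta>) ^ n)" if "\<zeta> \<in> ball 0 1" for \<zeta>
    by (simp add: bergman_integrand_def ker[OF that] mult_ac)
  have [measurable]: "cnj \<in> borel_measurable (lebesgue_on (ball 0 1))"
    by (intro measurable_lebesgue_on_borel borel_measurable_continuous_onI continuous_intros)
  note ps = integral_power_series[OF int, of cnj a z]
  show "integrable (lebesgue_on (ball 0 1)) (bergman_integrand \<omega> f z)"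
    using ps(1) z smz by (subst Bochner_Integration.integrable_cong[OF refl eq]) auto
  have "(\<lambda>n. a n * z ^ n * (LINT \<zeta>|lebesgue_on (ball 0 1). f \<zeta> * \<omega> (cmod \<zeta>) * cnj \<zeta> ^ n)) sums
     (LINT \<zeta>|lebesgue_on (ball 0 1). bergman_integrand \<omega> f z \<zeta>)"
    using ps(2) z smz by (subst Bochner_Integration.integral_cong[OF refl eq]) auto
  from sums_divide[OF this, of pi]
  show "(\<lambda>n. (LINT \<zeta>|lebesgue_on (ball 0 1). f \<zeta> * \<omega> (cmod \<zeta>) * cnj \<zeta> ^ n) / (2 * pi * moment \<omega> (2 * real n + 1)) * z ^ n)
        sums bergman_projection \<omega> f z"
    by (simp add: bergman_projection_def a_def mult_ac)
qed

lemma bergman_projection_holomorphic: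
  fixes f :: "complex \<Rightarrow> complex"
  assumes "radial_weight \<omega>" "integrable (lebesgue_on (ball 0 1)) (\<lambda>\<zeta>. f \<zeta> * \<omega> (cmod \<zeta>))"
  shows "bergman_projection \<omega> f holomorphic_on ball 0 1"
  by (rule power_series_holomorphic[where a="\<lambda>n. (LINT \<zeta>|lebesgue_on (ball 0 1). f \<zeta> * \<omega> (cmod \<zeta>) * cnj \<zeta> ^ n) /
      (2 * pi * moment \<omega> (2 * real n + 1))"]) (use bergman_projection_sums[OF assms] in simp)

subsection \<open>Growth and decay of tail integrals\<close>

text \<open>By the radial integration formula, the points of the disc whose modulus lies in a null
  set have area zero.\<close>

lemma AE_radial:
  assumes "AE t in lborel. t \<in> {0..<1::real} \<longrightarrow> P t"
  shows "AE z in lborel. z \<in> ball (0::complex) 1 \<longrightarrow> P (cmod z)"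
proof -
  obtain N where N: "N \<in> null_sets lborel" "{t. \<not> (t \<in> {0..<1} \<longrightarrow> P t)} \<subseteq> N"
    using assms by (auto simp: eventually_ae_filter)
  have [measurable]: "ball (0::complex) 1 \<in> sets borel" by simp
  from N have [measurable]: "N \<in> sets borel" by (auto simp: null_sets_def)
  have "(\<integral>\<^sup>+z\<in>ball (0::complex) 1. indicator N (cmod z) \<partial>lborel) = (\<integral>\<^sup>+t\<in>{0..<1}. ennreal (2*pi*t) * indicator N t \<partial>lborel)"
    by (rule nn_integral_disc_radial) measurable
  also have "\<dots> = (\<integral>\<^sup>+(t::real). 0 \<partial>lborel)"
    by (rule nn_integral_cong_AE, use AE_not_in[OF N(1)] in eventually_elim) auto
  finally have "(\<integral>\<^sup>+z\<in>ball (0::complex) 1. indicator N (cmod z) \<partial>lborel) = 0" by simp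
  then have "AE z in lborel. indicator N (cmod z) * indicator (ball (0::complex) 1) z = (0::ennreal)"
    by (subst (asm) nn_integral_0_iff_AE) measurable
  then show ?thesis
  proof eventually_elim
    case (elim z)
    show ?case
    proof
      assume "z \<in> ball 0 1"
      with elim have "cmod z \<notin> N" "cmod z \<in> {0..<1}" by (auto simp: indicator_def)
      then show "P (cmod z)" using N(2) norm_ge_zero[of z] by blast
    qed
  qed
qed

lemma D_hat_doubling:
  assumes "\<nu> \<in> D_hat"
  obtains C where "C \<ge> 1" "\<And>r. 0 \<le> r \<Longrightarrow> r < 1 \<Longrightarrow> tail \<nu> r \<le> C * tail \<nu> ((1 + r) / 2)"
proof -
  from assms obtain C where rw: "radial_weight \<nu>" and "C > 0"
    and ev: "\<forall>\<^sub>F r in at_left 1. tail \<nu> r \<le> C * tail \<nu> ((1 + r) / 2)"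
    by (auto simp: D_hat_def)
  obtain b where b: "b < 1" "\<And>r. b < r \<Longrightarrow> r < 1 \<Longrightarrow> tail \<nu> r \<le> C * tail \<nu> ((1 + r) / 2)"
    using ev by (auto simp: eventually_at_left[of 0 1])
  define b' where "b' = max 0 b"
  \<comment> \<open>On [0, b'] the asymptotic inequality says nothing; there monotonicity bounds the
    quotient of tails by its extreme value
    \<open>tail \<nu> 0 / tail \<nu> ((1 + b') / 2)\<close>.\<close>
  define D where "D = max C (max 1 (tail \<nu> 0 / tail \<nu> ((1 + b') / 2)))"
  have b': "0 \<le> b'" "b' < 1" "b \<le> b'" using b by (auto simp: b'_def)
  show ?thesis
  proof (rule that[of D])
    fix r :: real assume r: "0 \<le> r" "r < 1"
    have p: "0 < tail \<nu> ((1 + r) / 2)" "0 < tail \<nu> ((1 + b') / 2)" using rw r b' by (auto intro!: tail_pos)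
    show "tail \<nu> r \<le> D * tail \<nu> ((1 + r) / 2)"
    proof (cases "r > b'")
      case True
      then have "tail \<nu> r \<le> C * tail \<nu> ((1 + r) / 2)" using b r b' by auto
      also have "\<dots> \<le> D * tail \<nu> ((1 + r) / 2)" using p by (auto simp: D_def)
      finally show ?thesis .
    next
      case False
      have "tail \<nu> r \<le> tail \<nu> 0" using rw r by (intro tail_antimono) auto
      also have "\<dots> = tail \<nu> 0 / tail \<nu> ((1 + b') / 2) * tail \<nu> ((1 + b') / 2)" using p by simp
      also have "\<dots> \<le> D * tail \<nu> ((1 + r) / 2)"
        using False r p rw by (intro mult_mono tail_antimono) (auto simp: D_def)
      finally show ?thesis .
    qed
  qed (simp add: D_def)
qed

text \<open>Doubling is iterated k times with 2^k comparable to (1 - r) / (1 - t). The exponent is a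
  natural number because it later serves as the exponent of the standard weight.\<close>

lemma D_hat_growth:
  assumes "\<nu> \<in> D_hat"
  obtains b :: nat where
    "\<And>r t. 0 \<le> r \<Longrightarrow> r \<le> t \<Longrightarrow> t < 1 \<Longrightarrow> tail \<nu> r \<le> (2 * ((1 - r) / (1 - t))) ^ b * tail \<nu> t"
proof -
  have rw: "radial_weight \<nu>" using assms by (simp add: D_hat_def)
  obtain C where C: "C \<ge> 1" "\<And>r. 0 \<le> r \<Longrightarrow> r < 1 \<Longrightarrow> tail \<nu> r \<le> C * tail \<nu> ((1 + r) / 2)"
    using D_hat_doubling[OF assms] by metis
  obtain b :: nat where b: "C < 2 ^ b" using real_arch_pow[of 2 C] by auto
  have iter: "tail \<nu> r \<le> C ^ k * tail \<nu> (1 - (1 - r) / 2 ^ k)" if "0 \<le> r" "r < 1" for r k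
  proof (induction k)
    case (Suc k)
    have "(1 - r) / 2 ^ k \<le> 1 - r"
      using mult_left_mono[of 1 "2 ^ k" "1 - r"] that by (simp add: divide_le_eq)
    moreover have "0 < (1 - r) / 2 ^ k" using that by simp
    ultimately have "tail \<nu> (1 - (1 - r) / 2 ^ k) \<le> C * tail \<nu> ((1 + (1 - (1 - r) / 2 ^ k)) / 2)"
      using that by (intro C(2)) linarith+
    also have "(1 + (1 - (1 - r) / 2 ^ k)) / 2 = 1 - (1 - r) / 2 ^ Suc k" by (simp add: field_simps)
    finally have "C ^ k * tail \<nu> (1 - (1 - r) / 2 ^ k) \<le> C ^ k * (C * tail \<nu> (1 - (1 - r) / 2 ^ Suc k))"
      using C(1) by (intro mult_left_mono) auto
    with Suc show ?case by (simp add: mult_ac)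
  qed simp
  show ?thesis
  proof (rule that[of b])
    fix r t :: real assume rt: "0 \<le> r" "r \<le> t" "t < 1"
    define x where "x = (1 - r) / (1 - t)"
    have x: "x \<ge> 1" using rt by (simp add: x_def)
    define k where "k = (LEAST k. x \<le> 2 ^ k)"
    have "\<exists>k. x \<le> 2 ^ k" using real_arch_pow[of 2 x] by (auto intro: less_imp_le)
    then have k: "x \<le> 2 ^ k" unfolding k_def by (rule LeastI_ex)
    \<comment> \<open>Minimality of k costs at most a factor 2 from rounding up; this is the 2 in
      the conclusion.\<close>
    have k2: "2 ^ k \<le> 2 * x"
    proof (cases k)
      case (Suc j)
      then have "\<not> x \<le> 2 ^ j" unfolding k_def using not_less_Least[of j "\<lambda>k. x \<le> 2 ^ k"] by simp
      then show ?thesis using Suc by simp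
    qed (use x in simp)
    have "(1 - r) / 2 ^ k \<le> 1 - t" using k rt by (simp add: x_def field_simps)
    then have le: "tail \<nu> (1 - (1 - r) / 2 ^ k) \<le> tail \<nu> t" using rw rt by (intro tail_antimono) auto
    have "tail \<nu> r \<le> C ^ k * tail \<nu> (1 - (1 - r) / 2 ^ k)" using rt by (intro iter) auto
    also have "\<dots> \<le> (2 ^ b) ^ k * tail \<nu> t"
    proof (rule mult_mono[OF _ le])
      show "C ^ k \<le> (2 ^ b) ^ k" using b C(1) by (intro power_mono) auto
      have "(1 - r) / 2 ^ k \<le> 1 - r"
        using mult_left_mono[of 1 "2 ^ k" "1 - r"] rt by (simp add: divide_le_eq)
      then show "0 \<le> tail \<nu> (1 - (1 - r) / 2 ^ k)" using rt by (intro tail_nonneg[OF rw]) linarith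
    qed simp
    also have "(2 ^ b) ^ k = ((2::real) ^ k) ^ b" by (simp add: mult.commute flip: power_mult)
    also have "(2 ^ k) ^ b * tail \<nu> t \<le> (2 * x) ^ b * tail \<nu> t"
      using k2 rw rt by (intro mult_right_mono power_mono tail_nonneg) auto
    finally show "tail \<nu> r \<le> (2 * ((1 - r) / (1 - t))) ^ b * tail \<nu> t" by (simp add: x_def)
  qed
qed


lemma power_le_fact_exp:
  assumes "0 \<le> (y::real)" shows "y ^ b \<le> fact b * exp y"
proof -
  have "(\<Sum>n\<in>{b}. y ^ n /\<^sub>R fact n) \<le> (\<Sum>n. y ^ n /\<^sub>R fact n)"
    using assms by (intro sum_le_suminf summable_exp_generic) auto
  then show ?thesis by (simp add: exp_def field_simps)
qed

text \<open>The radius 1 - 1/(n+1) is where t^n stops being small. Beyond it monotonicity of the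
  tail suffices; before it the tail grows only polynomially in y = (n+1)(1-t), while t^n decays like
  exp(-y). Using n + 1 keeps the radius in [0,1) also for n = 0.\<close>

lemma D_hat_power:
  assumes "\<nu> \<in> D_hat"
  obtains C where "C > 0"
    "\<And>n t. 0 \<le> t \<Longrightarrow> t < 1 \<Longrightarrow> t ^ n * tail \<nu> t \<le> C * tail \<nu> (1 - 1 / (real n + 1))"
proof -
  have rw: "radial_weight \<nu>" using assms by (simp add: D_hat_def)
  obtain b where b: "\<And>r t. 0 \<le> r \<Longrightarrow> r \<le> t \<Longrightarrow> t < 1 \<Longrightarrow> tail \<nu> r \<le> (2 * ((1 - r) / (1 - t))) ^ b * tail \<nu> t"
    using D_hat_growth[OF assms] by metis
  \<comment> \<open>e comes from t^n \<le> exp(1 - y), 2^b from the growth bound, and b! bounds y^b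
    exp(-y).\<close>
  define C :: real where "C = exp 1 * 2 ^ b * fact b"
  have "1 * 1 * 1 \<le> C" unfolding C_def by (intro mult_mono) (auto simp: fact_ge_1)
  then have C1: "1 \<le> C" by simp
  show ?thesis
  proof (rule that[of C])
    fix n and t :: real assume t: "0 \<le> t" "t < 1"
    define T where "T = 1 - 1 / (real n + 1)"
    have T: "0 \<le> T" "T < 1" by (auto simp: T_def)
    show "t ^ n * tail \<nu> t \<le> C * tail \<nu> (1 - 1 / (real n + 1))"
    proof (cases "T \<le> t")
      case True
      then have "t ^ n * tail \<nu> t \<le> 1 * tail \<nu> T"
        using rw T t by (intro mult_mono tail_antimono power_le_one tail_nonneg) auto
      also have "\<dots> \<le> C * tail \<nu> T" using C1 rw T by (intro mult_right_mono tail_nonneg) auto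
      finally show ?thesis by (simp add: T_def)
    next
      case False
      define y where "y = (real n + 1) * (1 - t)"
      have y: "0 \<le> y" using t by (simp add: y_def)
      have "t ^ n \<le> exp (- (1 - t)) ^ n" using exp_ge_add_one_self[of "- (1 - t)"] t by (intro power_mono) auto
      also have "\<dots> = exp (- (real n * (1 - t)))" by (simp add: algebra_simps flip: exp_of_nat_mult)
      also have "\<dots> \<le> exp (1 - y)" using t by (simp add: y_def algebra_simps)
      finally have tn: "t ^ n \<le> exp (1 - y)" .
      have "tail \<nu> t \<le> (2 * y) ^ b * tail \<nu> T"
        using b[of t T] t False T by (simp add: T_def y_def mult.commute)
      then have "t ^ n * tail \<nu> t \<le> exp (1 - y) * ((2 * y) ^ b * tail \<nu> T)"
        using tn rw t by (intro mult_mono tail_nonneg) auto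
      also have "\<dots> \<le> exp (1 - y) * ((2 ^ b * (fact b * exp y)) * tail \<nu> T)"
        unfolding power_mult_distrib using power_le_fact_exp[OF y, of b] rw T
        by (intro mult_left_mono mult_right_mono tail_nonneg) auto
      also have "\<dots> = C * tail \<nu> T" by (simp add: C_def exp_diff)
      finally show ?thesis by (simp add: T_def)
    qed
  qed (use C1 in simp)
qed

text \<open>Iterating the inequality of \<open>D_check\<close> gains a factor C each time the
  distance to 1 shrinks by K, that is, decay with exponent log_K C. This holds past a threshold s;
  smaller radii are absorbed in the constant.\<close>

lemma D_check_decay:
  assumes "\<nu> \<in> D_check"
  obtains A \<gamma> where "A > 0" "\<gamma> > 0"
    "\<And>r t. 0 \<le> r \<Longrightarrow> r \<le> t \<Longrightarrow> t < 1 \<Longrightarrow> tail \<nu> t \<le> A * ((1 - t) / (1 - r)) powr \<gamma> * tail \<nu> r"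
proof -
  from assms obtain K C where rw: "radial_weight \<nu>" and K: "K > 1" and C: "C > 1"
    and ev: "\<forall>\<^sub>F r in at_left 1. tail \<nu> r \<ge> C * tail \<nu> (1 - (1 - r) / K)"
    by (auto simp: D_check_def)
  obtain b where b: "b < 1" "\<And>r. b < r \<Longrightarrow> r < 1 \<Longrightarrow> tail \<nu> r \<ge> C * tail \<nu> (1 - (1 - r) / K)"
    using ev by (auto simp: eventually_at_left[of 0 1])
  define s where "s = (1 + max 0 b) / 2"
  have s: "0 \<le> s" "s < 1" "b < s" using b by (auto simp: s_def)
  define \<gamma> where "\<gamma> = log K C"
  have \<gamma>: "\<gamma> > 0" using K C by (simp add: \<gamma>_def)
  have K\<gamma>: "K powr \<gamma> = C" using K C by (simp add: \<gamma>_def)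
  have iter: "C ^ k * tail \<nu> (1 - (1 - r) / K ^ k) \<le> tail \<nu> r" if "s \<le> r" "r < 1" for r k
  proof (induction k)
    case (Suc k)
    have "(1 - r) / K ^ k \<le> 1 - r" "0 < (1 - r) / K ^ k"
      using mult_left_mono[of 1 "K ^ k" "1 - r"] one_le_power[of K k] that K by (simp_all add: divide_le_eq)
    then have "C * tail \<nu> (1 - (1 - (1 - (1 - r) / K ^ k)) / K) \<le> tail \<nu> (1 - (1 - r) / K ^ k)"
      using that s by (intro b(2)) auto
    also have "1 - (1 - (1 - (1 - r) / K ^ k)) / K = 1 - (1 - r) / K ^ Suc k" by (simp add: mult.commute)
    finally have "C ^ k * (C * tail \<nu> (1 - (1 - r) / K ^ Suc k)) \<le> C ^ k * tail \<nu> (1 - (1 - r) / K ^ k)"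
      using C by (intro mult_left_mono) auto
    with Suc show ?case by (simp add: mult_ac)
  qed simp
  have far: "tail \<nu> t \<le> C * ((1 - t) / (1 - r)) powr \<gamma> * tail \<nu> r" if "s \<le> r" "r \<le> t" "t < 1" for r t
  proof -
    define x where "x = (1 - r) / (1 - t)"
    have x: "x \<ge> 1" using that by (simp add: x_def)
    \<comment> \<open>With k = j + 1 this gives K^j \<le> x < K^k: the left inequality permits j
      iterations before passing t, the right one compares x^\<gamma> with C^k. The step between j
      and k costs one factor C.\<close>
    define k where "k = (LEAST k. x < K ^ k)"
    have "\<exists>k. x < K ^ k" using real_arch_pow[OF K] .
    then have k: "x < K ^ k" unfolding k_def by (rule LeastI_ex)
    then obtain j where j: "k = Suc j" using x by (cases k) auto
    have kj: "K ^ j \<le> x" using not_less_Least[of j "\<lambda>k. x < K ^ k"] j unfolding k_def by simp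
    have "1 - t \<le> (1 - r) / K ^ j" using kj that K by (simp add: x_def field_simps)
    moreover have "(1 - r) / K ^ j \<le> 1 - r"
      using mult_left_mono[of 1 "K ^ j" "1 - r"] one_le_power[of K j] that K by (simp add: divide_le_eq)
    ultimately have "tail \<nu> t \<le> tail \<nu> (1 - (1 - r) / K ^ j)" using rw that s by (intro tail_antimono) auto
    then have "C ^ j * tail \<nu> t \<le> C ^ j * tail \<nu> (1 - (1 - r) / K ^ j)" using C by (intro mult_left_mono) auto
    also have "\<dots> \<le> tail \<nu> r" using that by (intro iter) auto
    finally have 1: "C ^ j * tail \<nu> t \<le> tail \<nu> r" .
    have "x powr \<gamma> \<le> (K ^ k) powr \<gamma>" using k x \<gamma> by (intro powr_mono2) auto
    also have "\<dots> = (K powr \<gamma>) ^ k" using K by (simp add: powr_powr mult.commute flip: powr_realpow)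
    also have "\<dots> = C * C ^ j" by (simp add: K\<gamma> j)
    finally have 2: "x powr \<gamma> \<le> C * C ^ j" .
    have xp: "0 < x powr \<gamma>" using x by simp
    have "x powr \<gamma> * tail \<nu> t \<le> C * C ^ j * tail \<nu> t" using 2 rw that s by (intro mult_right_mono tail_nonneg) auto
    also have "\<dots> \<le> C * tail \<nu> r" using 1 C by (simp add: mult.assoc)
    finally have "tail \<nu> t \<le> C * inverse (x powr \<gamma>) * tail \<nu> r" using xp by (simp add: field_simps)
    also have "inverse (x powr \<gamma>) = ((1 - t) / (1 - r)) powr \<gamma>"
      using that by (simp add: x_def powr_divide)
    finally show ?thesis .
  qed
  \<comment> \<open>The factor (1/(1-s))^\<gamma> pays for replacing 1 - r by 1 - s when r <
    s.\<close>
  define A where "A = C * (1 / (1 - s)) powr \<gamma>"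
  have s1: "(1 / (1 - s)) powr \<gamma> \<ge> 1" using s \<gamma> by (intro ge_one_powr_ge_zero) auto
  show ?thesis
  proof (rule that[of A \<gamma>])
    fix r t :: real assume rt: "0 \<le> r" "r \<le> t" "t < 1"
    have nn: "0 \<le> tail \<nu> r" "0 \<le> tail \<nu> s" using rw rt s by (auto intro!: tail_nonneg)
    show "tail \<nu> t \<le> A * ((1 - t) / (1 - r)) powr \<gamma> * tail \<nu> r"
    proof (cases "s \<le> r")
      case True
      then have "tail \<nu> t \<le> C * ((1 - t) / (1 - r)) powr \<gamma> * tail \<nu> r" using far rt by auto
      also have "\<dots> = (C * 1) * (((1 - t) / (1 - r)) powr \<gamma> * tail \<nu> r)" by simp
      also have "\<dots> \<le> A * (((1 - t) / (1 - r)) powr \<gamma> * tail \<nu> r)"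
        unfolding A_def using s1 C nn by (intro mult_mono) auto
      finally show ?thesis by (simp add: mult_ac)
    next
      case False
      have eq: "A * ((1 - t) / (1 - r)) powr \<gamma> = C * (((1 - t) / (1 - r)) * (1 / (1 - s))) powr \<gamma>"
        using rt s unfolding A_def by (subst powr_mult) auto
      show ?thesis
      proof (cases "s < t")
        case True
        have "tail \<nu> t \<le> C * ((1 - t) / (1 - s)) powr \<gamma> * tail \<nu> s" using far[of s t] True rt by auto
        also have "\<dots> \<le> C * (((1 - t) / (1 - r)) * (1 / (1 - s))) powr \<gamma> * tail \<nu> r"
        proof (intro mult_mono mult_left_mono powr_mono2)
          have "(1 - t) / (1 - s) * 1 \<le> (1 - t) / (1 - s) * (1 / (1 - r))" using rt s by (intro mult_left_mono) auto
          then show "(1 - t) / (1 - s) \<le> (1 - t) / (1 - r) * (1 / (1 - s))" by (simp add: mult.commute)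
          show "tail \<nu> s \<le> tail \<nu> r" using False rw rt by (intro tail_antimono) auto
        qed (use C \<gamma> nn rt s in auto)
        finally show ?thesis by (simp only: eq)
      next
        case False
        \<comment> \<open>Both radii lie below the threshold: the enlarged constant already makes
          the claimed factor at least 1, and monotonicity is enough.\<close>
        have "(1 - s) * (1 - r) \<le> (1 - t) * 1" using False rt s by (intro mult_mono) auto
        then have "1 \<le> ((1 - t) / (1 - r)) * (1 / (1 - s))" using rt s by (simp add: pos_le_divide_eq mult.commute)
        then have "1 \<le> (((1 - t) / (1 - r)) * (1 / (1 - s))) powr \<gamma>" using \<gamma> by (intro ge_one_powr_ge_zero) auto
        then have le: "1 * 1 \<le> C * (((1 - t) / (1 - r)) * (1 / (1 - s))) powr \<gamma>" using C by (intro mult_mono) auto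
        have "tail \<nu> t \<le> 1 * tail \<nu> r" using rw rt tail_antimono[of \<nu> r t] by auto
        also have "\<dots> \<le> C * (((1 - t) / (1 - r)) * (1 / (1 - s))) powr \<gamma> * tail \<nu> r"
          using le nn by (intro mult_right_mono) auto
        finally show ?thesis by (simp only: eq)
      qed
    qed
  qed (use C s \<gamma> in \<open>auto simp: A_def\<close>)
qed

subsection \<open>Necessity\<close>

lemma AE_lebesgue_on_ball:
  "(AE z in lebesgue_on (ball (0::complex) 1). P z) \<longleftrightarrow> (AE z in lborel. z \<in> ball 0 1 \<longrightarrow> P z)"
  by (subst AE_restrict_space_iff) (auto simp: AE_completion_iff)

lemma nn_integral_lebesgue_on_ball:
  fixes F :: "complex \<Rightarrow> ennreal"
  shows "(\<integral>\<^sup>+z. F z \<partial>lebesgue_on (ball 0 1)) = (\<integral>\<^sup>+z\<in>ball 0 1. F z \<partial>lborel)"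
  by (subst nn_integral_restrict_space) (auto simp: nn_integral_completion)

lemma L_infE:
  assumes rw: "radial_weight \<nu>" and fin: "f \<in> L_inf \<nu>"
  obtains M where "M \<ge> 0" "weighted_norm \<nu> f = ereal M"
    "AE z in lebesgue_on (ball 0 1). cmod (f z) \<le> M / tail \<nu> (cmod z)"
proof -
  let ?D = "lebesgue_on (ball (0::complex) 1)"
  let ?g = "\<lambda>z. ereal (cmod (f z) * tail \<nu> (cmod z))"
  have "(\<lambda>z::complex. tail \<nu> (cmod z)) \<in> borel_measurable ?D"
    by (intro measurable_lebesgue_on_borel measurable_tail_norm rw)
  then have meas: "?g \<in> borel_measurable ?D"
    using fin by (auto simp: L_inf_def)
  \<comment> \<open>The norm is an extended real; on a null space the essential supremum would be -
    \<infinity>. Positive area of the disc excludes this.\<close>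
  have "emeasure ?D (space ?D) \<noteq> 0"
    by (subst emeasure_restrict_space) (auto simp: emeasure_ball unit_ball_vol_2)
  then have "0 = esssup ?D (\<lambda>z. 0::ereal)" by (simp add: esssup_const)
  also have "\<dots> \<le> weighted_norm \<nu> f"
    unfolding weighted_norm_def by (intro esssup_mono) (auto intro!: mult_nonneg_nonneg tail_nonneg rw)
  finally have "0 \<le> weighted_norm \<nu> f" .
  moreover have "weighted_norm \<nu> f < \<infinity>" using fin by (simp add: L_inf_def)
  ultimately obtain M where M: "M \<ge> 0" "weighted_norm \<nu> f = ereal M"
    by (cases "weighted_norm \<nu> f") auto
  have "AE z in ?D. ?g z \<le> ereal M" using esssup_AE[of ?g ?D] M(2) by (simp add: weighted_norm_def)
  then have "AE z in ?D. cmod (f z) \<le> M / tail \<nu> (cmod z)"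
    unfolding AE_lebesgue_on_ball by eventually_elim (auto simp: tail_pos[OF rw] pos_le_divide_eq)
  with M show ?thesis by (rule that)
qed

lemma weighted_norm_le:
  assumes rw: "radial_weight \<nu>" and "f \<in> borel_measurable (lebesgue_on (ball 0 1))"
    and "\<And>z. z \<in> ball 0 1 \<Longrightarrow> cmod (f z) * tail \<nu> (cmod z) \<le> M"
  shows "weighted_norm \<nu> f \<le> ereal M" "f \<in> L_inf \<nu>"
proof -
  have "(\<lambda>z::complex. tail \<nu> (cmod z)) \<in> borel_measurable (lebesgue_on (ball 0 1))"
    by (intro measurable_lebesgue_on_borel measurable_tail_norm rw)
  then show "weighted_norm \<nu> f \<le> ereal M"
    unfolding weighted_norm_def using assms by (intro esssup_I AE_I2) auto
  then show "f \<in> L_inf \<nu>" using assms(2) by (auto simp: L_inf_def intro: le_less_trans)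
qed

section \<open>Fourier coefficients of the argument\<close>

lemma measurable_Arg2pi [measurable]: "Arg2pi \<in> borel_measurable borel"
  unfolding borel_measurable_iff_le using closed_Arg2pi2pi_le by (auto intro: borel_closed)

text \<open>The circle is traversed starting from z, as the circle average requires, so the jump of
  the sawtooth falls inside the interval, at 2 \<pi> minus the argument of z.\<close>

lemma has_integral_Fourier_Arg2pi:
  assumes n: "n \<ge> 1" and z: "z \<noteq> 0"
  shows "((\<lambda>\<theta>. Arg2pi (cis \<theta> * z) * cnj (cis \<theta> * z) ^ n) has_integral (2 * pi * \<i> / n * cmod z ^ n)) {0..2*pi}"
proof -
  define \<alpha> where "\<alpha> = Arg2pi z"
  have \<alpha>: "0 \<le> \<alpha>" "\<alpha> < 2 * pi" and z_eq: "z = cmod z * cis \<alpha>"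
    using Arg2pi[of z] by (auto simp: \<alpha>_def is_Arg_def cis_conv_exp)
  \<comment> \<open>A primitive of \<open>s exp (- \<i> n s)\<close>; the interval is split where the argument jumps by \<open>2 \<pi>\<close>.\<close>
  define \<Phi> where "\<Phi> = (\<lambda>s::complex. (\<i> * s / n + 1 / n^2) * exp (- \<i> * n * s))"
  define q where "q = (\<lambda>s::real. complex_of_real s * cis (- (n * s)))"
  have cis_exp: "cis (- (n * s)) = exp (- \<i> * n * complex_of_real s)" for s :: real
    by (simp add: cis_conv_exp algebra_simps)
  have \<Phi>': "(\<Phi> has_field_derivative s * exp (- \<i> * n * s)) (at s)" for s
    unfolding \<Phi>_def using n by (auto intro!: derivative_eq_intros simp: field_simps power2_eq_square)
  have q: "((\<lambda>\<theta>. q (\<theta> + c)) has_integral (\<Phi> (complex_of_real (b + c)) - \<Phi> (complex_of_real (a + c)))) {a..b}" if "a \<le> b" for a b c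
  proof (rule fundamental_theorem_of_calculus[OF that])
    fix x
    have "((\<lambda>s. \<Phi> (s + c)) has_field_derivative (x + c) * exp (- \<i> * n * (x + c))) (at (complex_of_real x))"
      using \<Phi>'[of "complex_of_real x + complex_of_real c"] by (simp only: DERIV_shift of_real_add)
    from has_vector_derivative_real_field[OF this]
    show "((\<lambda>x. \<Phi> (complex_of_real (x + c))) has_vector_derivative q (x + c)) (at x within {a..b})"
      by (simp add: q_def cis_exp)
  qed
  have pow: "cnj (cis \<theta> * z) ^ n = cmod z ^ n * cis (- (n * (\<theta> + \<alpha>)))" for \<theta>
  proof -
    have "cnj (cis \<theta> * z) = cmod z * cis (- (\<theta> + \<alpha>))"
      by (subst z_eq) (simp add: cis_cnj cis_mult algebra_simps)
    then show ?thesis by (simp only: power_mult_distrib Complex.DeMoivre of_real_power mult_minus_right)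
  qed
  have arg: "Arg2pi (cis \<theta> * z) = s" if "0 \<le> s" "s < 2 * pi" "cis s = cis (\<theta> + \<alpha>)" for s \<theta>
  proof (rule Arg2pi_unique)
    show "complex_of_real (cmod z) * exp (\<i> * complex_of_real s) = cis \<theta> * z"
      unfolding cis_conv_exp[symmetric] that(3) by (subst (2) z_eq) (simp add: cis_mult[symmetric])
  qed (use z that in auto)
  let ?f = "\<lambda>\<theta>. Arg2pi (cis \<theta> * z) * cnj (cis \<theta> * z) ^ n"
  let ?c = "complex_of_real (cmod z ^ n)"
  \<comment> \<open>At the right endpoint the argument has already fallen back to 0, hence the
    exceptional point.\<close>
  have 1: "(?f has_integral ?c * (\<Phi> (complex_of_real (2 * pi - \<alpha> + \<alpha>)) - \<Phi> (complex_of_real (0 + \<alpha>)))) {0..2*pi - \<alpha>}"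
  proof (rule has_integral_spike_finite[of "{2*pi - \<alpha>}", OF _ _ has_integral_mult_right[OF q]])
    fix \<theta> assume "\<theta> \<in> {0..2*pi - \<alpha>} - {2*pi - \<alpha>}"
    then have "Arg2pi (cis \<theta> * z) = \<theta> + \<alpha>" using \<alpha> by (intro arg) auto
    then show "?f \<theta> = ?c * q (\<theta> + \<alpha>)" by (simp add: pow q_def del: complex_cnj_mult)
  qed (use \<alpha> in auto)
  have cis2: "cis (\<theta> - 2 * pi) = cis \<theta>" for \<theta>
    by (simp add: cis_divide[symmetric])
  have 2: "(?f has_integral ?c * (\<Phi> (complex_of_real (2 * pi + (\<alpha> - 2 * pi))) - \<Phi> (complex_of_real (2 * pi - \<alpha> + (\<alpha> - 2 * pi))))) {2*pi - \<alpha>..2*pi}"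
  proof (rule has_integral_spike_finite[of "{}", OF _ _ has_integral_mult_right[OF q]])
    fix \<theta> assume "\<theta> \<in> {2*pi - \<alpha>..2*pi} - {}"
    then have "Arg2pi (cis \<theta> * z) = \<theta> + (\<alpha> - 2 * pi)"
      using \<alpha> cis2[of "\<theta> + \<alpha>"] by (intro arg) (auto simp: algebra_simps)
    moreover have "cis (- (n * (\<theta> + (\<alpha> - 2 * pi)))) = cis (- (n * (\<theta> + \<alpha>)))"
    proof -
      have "cis (- (n * (\<theta> + (\<alpha> - 2 * pi)))) = cis (- (n * (\<theta> + \<alpha>))) * cis (2 * pi * n)"
        by (simp add: cis_mult algebra_simps)
      then show ?thesis by (simp add: cis_multiple_2pi)
    qed
    ultimately show "?f \<theta> = ?c * q (\<theta> + (\<alpha> - 2 * pi))" by (simp add: pow q_def del: complex_cnj_mult)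
  qed (use \<alpha> in auto)
  \<comment> \<open>The values at \<alpha> cancel between the two pieces. The exponential is 1 at
    both 0 and 2 \<pi>, so only the linear term i s / n contributes.\<close>
  have "\<Phi> (complex_of_real (2 * pi)) - \<Phi> 0 = 2 * pi * \<i> / n"
  proof -
    have "exp (- \<i> * n * complex_of_real (2 * pi)) = cis (- (n * (2 * pi)))" by (simp add: cis_exp)
    also have "\<dots> = 1" using cis_multiple_2pi[of "- real n"] by (simp add: mult_ac)
    finally show ?thesis by (simp add: \<Phi>_def algebra_simps)
  qed
  then have *: "2 * pi * \<i> / n * cmod z ^ n = ?c * (\<Phi> (complex_of_real (2 * pi - \<alpha> + \<alpha>)) - \<Phi> (complex_of_real (0 + \<alpha>))) +
     ?c * (\<Phi> (complex_of_real (2 * pi + (\<alpha> - 2 * pi))) - \<Phi> (complex_of_real (2 * pi - \<alpha> + (\<alpha> - 2 * pi))))"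
    by (simp add: algebra_simps)
  show ?thesis
    unfolding * by (rule has_integral_combine[OF _ _ 1 2]) (use \<alpha> in auto)
qed

lemma Fourier_Arg2pi:
  assumes n: "n \<ge> 1"
  shows "(LINT \<theta>:{0..2*pi}|lborel. Arg2pi (cis \<theta> * z) * cnj (cis \<theta> * z) ^ n) = 2 * pi * \<i> / n * cmod z ^ n"
proof (cases "z = 0")
  case False
  have [measurable]: "cnj \<in> borel_measurable borel" by (intro borel_measurable_continuous_onI continuous_intros)
  have "set_integrable lborel {0..2*pi} (\<lambda>\<theta>. Arg2pi (cis \<theta> * z) * cnj (cis \<theta> * z) ^ n)"
    unfolding set_integrable_def
  proof (rule Bochner_Integration.integrable_bound)
    show "integrable lborel (\<lambda>\<theta>. indicator {0..2*pi} \<theta> * (2 * pi * cmod z ^ n))"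
      by simp
    show "AE \<theta> in lborel. norm (indicator {0..2*pi} \<theta> *\<^sub>R (Arg2pi (cis \<theta> * z) * cnj (cis \<theta> * z) ^ n)) \<le>
       norm (indicator {0..2*pi} \<theta> * (2 * pi * cmod z ^ n))"
      using Arg2pi by (auto simp: norm_mult norm_power abs_mult abs_of_nonneg less_imp_le intro!: mult_mono)
  qed measurable
  from set_borel_integral_eq_integral(2)[OF this] has_integral_Fourier_Arg2pi[OF n False]
  show ?thesis by (simp add: integral_unique)
qed (use n in \<open>simp add: set_lebesgue_integral_def\<close>)

section \<open>From the series inequality to \<open>D_check\<close>\<close>

text \<open>Each dyadic block from 2^j N to 2^(j+1) N has 2^j N terms of size at least 1/(2^(j+1)
  N), hence contributes at least 1/2.\<close>

lemma sum_inverse_dyadic: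
  assumes "N \<ge> 1" shows "real j / 2 \<le> (\<Sum>n\<in>{N<..2^j*N}. 1 / real n)"
proof (induction j)
  case (Suc j)
  have le: "N \<le> 2 ^ j * N" "2 ^ j * N \<le> 2 ^ Suc j * N" by auto
  have "1 / 2 = (\<Sum>n\<in>{2^j*N<..2^Suc j*N}. 1 / real (2^Suc j*N))"
    using assms by (simp add: field_simps)
  also have "\<dots> \<le> (\<Sum>n\<in>{2^j*N<..2^Suc j*N}. 1 / real n)"
    using assms by (intro sum_mono divide_left_mono) (auto simp del: of_nat_mult of_nat_power power_Suc)
  finally have "real (Suc j) / 2 \<le> (\<Sum>n\<in>{N<..2^j*N}. 1 / real n) + (\<Sum>n\<in>{2^j*N<..2^Suc j*N}. 1 / real n)"
    using Suc by simp
  also have "\<dots> = (\<Sum>n\<in>{N<..2^j*N} \<union> {2^j*N<..2^Suc j*N}. 1 / real n)"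
    by (rule sum.union_disjoint[symmetric]) auto
  also have "{N<..2^j*N} \<union> {2^j*N<..2^Suc j*N} = {N<..2^Suc j*N}"
    using le by (intro ivl_disj_un)
  finally show ?case .
qed simp

text \<open>For n between N, about 1/(1-r), and 2^j N, the power x^n is at least 1/2 and the tail in
  the denominator is at most \<open>tail \<nu> r\<close>. The sum is therefore at least j / (4
  \<open>tail \<nu> r\<close>), and comparison with the hypothesis at a radius r' beyond x halves
  the tail.\<close>

lemma D_check_criterion:
  assumes rw: "radial_weight \<nu>"
    and B: "\<And>x r m. 0 \<le> x \<Longrightarrow> x < r \<Longrightarrow> r < 1 \<Longrightarrow>
      (\<Sum>n\<in>{1..m}. x ^ n / (real n * tail \<nu> (1 - 1 / (real n + 1)))) \<le> B / tail \<nu> r"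
  shows "\<nu> \<in> D_check"
proof -
  \<comment> \<open>8 = 2 * 2 * 2: one factor from the harmonic sum j/2, one from x^n \<ge> 1/2, one
    for the gain C = 2.\<close>
  obtain j :: nat where j: "8 * B \<le> real j" using real_arch_simple by blast
  have main: "2 * tail \<nu> (1 - (1 - r) / 2 ^ (j + 3)) \<le> tail \<nu> r" if r: "0 \<le> r" "r < 1" for r
  proof -
    define y where "y = 1 / (1 - r)"
    have y: "1 \<le> y" using r by (simp add: y_def)
    define N where "N = nat \<lceil>y\<rceil>"
    have N: "1 \<le> N" "y \<le> real N" "real N \<le> 2 * y"
      using y by (auto simp: N_def) linarith+
    \<comment> \<open>As n \<le> 2^j N \<le> 2^(j+1) / (1-r), this makes n d \<le> 1/2, and
      Bernoulli gives x^n \<ge> 1/2. The radius r' = 1 - d/2 lies strictly beyond x.\<close>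
    define d where "d = (1 - r) / 2 ^ (j + 2)"
    define x where "x = 1 - d"
    define r' where "r' = 1 - (1 - r) / 2 ^ (j + 3)"
    have d: "0 < d" "d \<le> 1"
      using r one_le_power[of "2::real" "j+2"] unfolding d_def by (simp, subst divide_le_eq_1_pos) linarith+
    have r': "r' = 1 - d / 2" by (simp add: r'_def d_def power_add)
    have t: "0 < tail \<nu> r" "0 < tail \<nu> r'" using rw r d by (auto simp: r' intro!: tail_pos)
    have le_term: "1 / real n * (1 / (2 * tail \<nu> r)) \<le> x ^ n / (real n * tail \<nu> (1 - 1 / (real n + 1)))"
      if n: "n \<in> {N<..2^j*N}" for n
    proof -
      have n1: "1 \<le> n" "N \<le> n" "n \<le> 2 ^ j * N" using n by auto
      have "real n \<le> 2 ^ j * real N" using n1(3) by (metis of_nat_le_iff of_nat_mult of_nat_numeral of_nat_power)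
      also have "\<dots> \<le> 2 ^ j * (2 * y)" using N by (intro mult_left_mono) auto
      finally have "real n * d \<le> 2 ^ j * (2 * y) * d" using d by (intro mult_right_mono) auto
      also have "\<dots> = 1 / 2" using r by (simp add: y_def d_def power_add)
      finally have "1 / 2 \<le> 1 + real n * (- d)" by simp
      also have "\<dots> \<le> (1 + (- d)) ^ n" using d by (intro Bernoulli_inequality) auto
      finally have xn: "1 / 2 \<le> x ^ n" by (simp add: x_def)
      have "y \<le> real n + 1" using N n1 by linarith
      then have "1 / (real n + 1) \<le> 1 / y" using y by (intro divide_left_mono) auto
      then have "r \<le> 1 - 1 / (real n + 1)" by (simp add: y_def)
      then have "tail \<nu> (1 - 1 / (real n + 1)) \<le> tail \<nu> r" using rw r by (intro tail_antimono) auto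
      moreover have "0 < tail \<nu> (1 - 1 / (real n + 1))" using rw n1 by (intro tail_pos) auto
      ultimately have "(1 / 2) / (real n * tail \<nu> r) \<le> x ^ n / (real n * tail \<nu> (1 - 1 / (real n + 1)))"
        using xn n1 by (intro frac_le mult_left_mono mult_pos_pos) auto
      then show ?thesis by (simp add: mult_ac)
    qed
    have "2 * B / tail \<nu> r \<le> (real j / 2) * (1 / (2 * tail \<nu> r))"
      using j t by (simp add: field_simps)
    also have "\<dots> \<le> (\<Sum>n\<in>{N<..2^j*N}. 1 / real n) * (1 / (2 * tail \<nu> r))"
      using sum_inverse_dyadic[OF N(1)] t by (intro mult_right_mono) auto
    also have "\<dots> = (\<Sum>n\<in>{N<..2^j*N}. 1 / real n * (1 / (2 * tail \<nu> r)))"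
      by (rule sum_distrib_right)
    also have "\<dots> \<le> (\<Sum>n\<in>{N<..2^j*N}. x ^ n / (real n * tail \<nu> (1 - 1 / (real n + 1))))"
      by (rule sum_mono[OF le_term])
    also have "\<dots> \<le> (\<Sum>n\<in>{1..2^j*N}. x ^ n / (real n * tail \<nu> (1 - 1 / (real n + 1))))"
      using d by (intro sum_mono2) (auto simp: x_def intro!: divide_nonneg_nonneg mult_nonneg_nonneg tail_nonneg rw)
    also have "\<dots> \<le> B / tail \<nu> r'"
      using d by (intro B) (auto simp: x_def r')
    finally have le: "2 * B / tail \<nu> r \<le> B / tail \<nu> r'" .
    \<comment> \<open>A single positive term shows B > 0, so that B can be cancelled.\<close>
    have "0 < (1/4) ^ 1 / (real 1 * tail \<nu> (1 - 1 / (real 1 + 1)))"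
      using tail_pos[OF rw, of "1/2"] by simp
    also have "\<dots> \<le> B / tail \<nu> (1/2)" using B[of "1/4" "1/2" 1] by simp
    finally have "0 < B" using tail_pos[OF rw, of "1/2"] by (simp add: zero_less_divide_iff)
    with le t have "2 * tail \<nu> r' \<le> tail \<nu> r" by (simp add: field_simps)
    then show ?thesis by (simp add: r'_def)
  qed
  have "\<forall>\<^sub>F r in at_left 1. tail \<nu> r \<ge> 2 * tail \<nu> (1 - (1 - r) / 2 ^ (j + 3))"
    using main by (auto simp: eventually_at_left[of 0 1] intro!: exI[of _ 0])
  moreover have "(1::real) < 2 ^ (j + 3)" by (rule one_less_power) auto
  ultimately show ?thesis using rw unfolding D_check_def
    by (intro CollectI conjI exI[of _ "2 ^ (j + 3)"] exI[of _ 2]) auto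
qed

section \<open>The projection of the test function\<close>

text \<open>Passes from a Lebesgue measurable integrand on the disc to a Borel one on the plane,
  extended by zero, to which the circle average applies.\<close>

lemma
  fixes G H :: "complex \<Rightarrow> 'a::{banach, second_countable_topology}"
  assumes G: "G \<in> borel_measurable (lebesgue_on (ball 0 1))" and H: "H \<in> borel_measurable borel"
    and eq: "AE z in lborel. z \<in> ball 0 1 \<longrightarrow> G z = H z" and H0: "\<And>z. z \<notin> ball 0 1 \<Longrightarrow> H z = 0"
  shows integrable_lebesgue_on_ball_iff: "integrable (lebesgue_on (ball 0 1)) G \<longleftrightarrow> integrable lborel H"
    and integral_lebesgue_on_ball: "(LINT z|lebesgue_on (ball 0 1). G z) = (LINT z|lborel. H z)"
proof -
  let ?D = "lebesgue_on (ball (0::complex) 1)"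
  have HD: "H \<in> borel_measurable ?D" by (rule measurable_lebesgue_on_borel[OF H])
  have H0': "indicat_real (ball 0 1) z *\<^sub>R H z = H z" for z using H0[of z] by (auto simp: indicator_def)
  have ae: "AE z in ?D. G z = H z" using eq by (simp only: AE_lebesgue_on_ball)
  have "integrable ?D G \<longleftrightarrow> integrable ?D H"
    by (rule integrable_cong_AE[OF G HD ae])
  also have "\<dots> \<longleftrightarrow> integrable lborel H"
    by (subst integrable_restrict_space) (use H in \<open>auto simp: H0' integrable_completion\<close>)
  finally show "integrable ?D G \<longleftrightarrow> integrable lborel H" .
  have "(LINT z|?D. G z) = (LINT z|?D. H z)" by (rule integral_cong_AE[OF G HD ae])
  also have "\<dots> = (LINT z|lborel. H z)"
    by (subst integral_restrict_space) (use H in \<open>auto simp: H0' integral_completion\<close>)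
  finally show "(LINT z|?D. G z) = (LINT z|lborel. H z)" .
qed

text \<open>One factor t of t^(2n+1) is the Jacobian of polar coordinates.\<close>

lemma moment_eq_disc_integral:
  assumes rw: "radial_weight \<omega>" and [measurable]: "w \<in> borel_measurable borel"
    and w: "\<And>t. 0 \<le> w t" "\<And>t. t \<notin> {0..<1} \<Longrightarrow> w t = 0" "integrable lborel w"
      "AE t in lborel. t \<in> {0..<1} \<longrightarrow> \<omega> t = w t"
  shows "ennreal (2 * pi * moment \<omega> (2 * real n + 1)) = (\<integral>\<^sup>+z\<in>ball (0::complex) 1. ennreal (cmod z ^ (2 * n) * w (cmod z)) \<partial>lborel)"
proof -
  let ?g = "\<lambda>t. t ^ (2 * n + 1) * w t"
  have int: "integrable lborel ?g"
  proof (rule Bochner_Integration.integrable_bound[OF w(3)])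
    have "norm (?g t) \<le> norm (w t)" for t
    proof (cases "t \<in> {0..<1}")
      case True
      then have "t ^ (2 * n + 1) \<le> 1" by (intro power_le_one) auto
      then have "t ^ (2 * n + 1) * w t \<le> 1 * w t" using w(1) by (intro mult_right_mono)
      then show ?thesis using True w(1)[of t] by (simp add: abs_mult abs_of_nonneg)
    qed (simp add: w(2))
    then show "AE t in lborel. norm (?g t) \<le> norm (w t)" by simp
  qed measurable
  have powr: "r powr (2 * real n + 1) = r ^ (2 * n + 1)" if "0 \<le> r" for r :: real
    using that powr_realpow'[of r "2 * n + 1"] by (simp add: add.commute)
  have "moment \<omega> (2 * real n + 1) = (LINT r|lebesgue. indicator {0..<1} r *\<^sub>R (r powr (2 * real n + 1) * \<omega> r))"
    unfolding moment_def by (subst integral_restrict_space) auto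
  also have "\<dots> = (LINT r|lebesgue. ?g r)"
  proof (rule integral_cong_AE)
    have "integrable lebesgue (\<lambda>s. indicator {0..<1} s *\<^sub>R \<omega> s)"
      using rw unfolding radial_weight_def by (subst (asm) integrable_restrict_space) auto
    then have "(\<lambda>r. (r powr (2 * real n + 1)) * (indicator {0..<1} r *\<^sub>R \<omega> r)) \<in> borel_measurable lebesgue"
      by (intro borel_measurable_times[OF measurable_completion borel_measurable_integrable]) auto
    then show "(\<lambda>r. indicator {0..<1} r *\<^sub>R (r powr (2 * real n + 1) * \<omega> r)) \<in> borel_measurable lebesgue"
      by (simp add: mult_ac)
    show "AE r in lebesgue. indicator {0..<1} r *\<^sub>R (r powr (2 * real n + 1) * \<omega> r) = ?g r"
      unfolding AE_completion_iff using w(4)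
    proof eventually_elim
      case (elim r)
      then show ?case using powr[of r] w(2)[of r] by (cases "r \<in> {0..<1}") auto
    qed
  qed (auto intro!: measurable_completion)
  also have "\<dots> = (LINT r|lborel. ?g r)" by (rule integral_completion) auto
  finally have "ennreal (2 * pi * moment \<omega> (2 * real n + 1)) = ennreal (LINT r|lborel. 2 * pi * ?g r)"
    by simp
  also have "\<dots> = (\<integral>\<^sup>+r. ennreal (2 * pi * ?g r) \<partial>lborel)"
  proof (rule nn_integral_eq_integral[symmetric])
    have "0 \<le> 2 * pi * ?g t" for t
      using w(1)[of t] w(2)[of t] by (cases "t \<in> {0..<1}") auto
    then show "AE t in lborel. 0 \<le> 2 * pi * ?g t" by simp
  qed (use int in simp)
  also have "\<dots> = (\<integral>\<^sup>+t\<in>{0..<1}. ennreal (2 * pi * t) * ennreal (t ^ (2 * n) * w t) \<partial>lborel)"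
  proof (intro nn_integral_cong)
    fix t show "ennreal (2 * pi * ?g t) = ennreal (2 * pi * t) * ennreal (t ^ (2 * n) * w t) * indicator {0..<1} t"
      using w(1)[of t] w(2)[of t] by (cases "t \<in> {0..<1}") (auto simp: ennreal_mult[symmetric] mult_ac)
  qed
  also have "\<dots> = (\<integral>\<^sup>+z\<in>ball (0::complex) 1. ennreal (cmod z ^ (2 * n) * w (cmod z)) \<partial>lborel)"
    by (rule nn_integral_disc_radial[symmetric]) measurable
  finally show ?thesis .
qed

text \<open>At z = 0 the kernel is a nonzero constant, so the integrability demanded by boundedness
  is that of f \<omega> itself.\<close>

lemma bounded_projection_integrable:
  assumes rw: "radial_weight \<omega>" and bd: "bergman_projection_bounded \<omega> \<nu>" and f: "f \<in> L_inf \<nu>"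
  shows "integrable (lebesgue_on (ball 0 1)) (\<lambda>\<zeta>. f \<zeta> * \<omega> (cmod \<zeta>))"
proof -
  have m: "0 < moment \<omega> 1" using moment_pos[OF rw] by simp
  have "bergman_kernel \<omega> 0 \<zeta> = 1 / (2 * moment \<omega> 1)" for \<zeta>
    using powser_zero[of "\<lambda>n. 1 / complex_of_real (2 * moment \<omega> (2 * real n + 1))"] by (simp add: bergman_kernel_def)
  then have "bergman_integrand \<omega> f 0 = (\<lambda>\<zeta>. f \<zeta> * \<omega> (cmod \<zeta>) / (2 * moment \<omega> 1))"
    by (auto simp: bergman_integrand_def)
  moreover have "integrable (lebesgue_on (ball 0 1)) (bergman_integrand \<omega> f 0)"
    using bd f by (auto simp: bergman_projection_bounded_def)
  ultimately have "integrable (lebesgue_on (ball 0 1)) (\<lambda>\<zeta>. (f \<zeta> * \<omega> (cmod \<zeta>) / (2 * moment \<omega> 1)) * (2 * moment \<omega> 1))"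
    by (intro integrable_mult_left) simp
  then show ?thesis using m by simp
qed

text \<open>The set where the inequality fails is open and null, hence empty.\<close>

lemma AE_le_imp_le_open:
  fixes f :: "complex \<Rightarrow> real"
  assumes "open U" "continuous_on U f" and ae: "AE z in lborel. z \<in> U \<longrightarrow> f z \<le> c" and "x \<in> U"
  shows "f x \<le> c"
proof (rule ccontr)
  assume "\<not> f x \<le> c"
  let ?V = "U \<inter> f -` {c<..}"
  have "open ?V" using assms by (intro continuous_open_preimage) auto
  moreover have "x \<in> ?V" using \<open>\<not> f x \<le> c\<close> assms by auto
  moreover have "negligible ?V"
  proof -
    have "AE z in lborel. z \<notin> ?V" using ae by eventually_elim auto
    then have "?V \<in> null_sets lborel"
      using AE_iff_null_sets[of ?V lborel] borel_open[OF \<open>open ?V\<close>] by simp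
    then show ?thesis by (auto simp: negligible_iff_null_sets intro: null_sets_completionI)
  qed
  ultimately show False using open_not_negligible by blast
qed

theorem bounded_projection_imp_D_check:
  assumes \<nu>: "\<nu> \<in> D_hat" and rw\<omega>: "radial_weight \<omega>" and bd: "bergman_projection_bounded \<omega> \<nu>"
  shows "\<nu> \<in> D_check"
proof -
  let ?D = "lebesgue_on (ball (0::complex) 1)"
  have rw: "radial_weight \<nu>" using \<nu> by (simp add: D_hat_def)
  note [measurable] = measurable_tail_norm[OF rw]
  have [measurable]: "cnj \<in> borel_measurable borel" by (intro borel_measurable_continuous_onI continuous_intros)
  obtain w where w [measurable]: "w \<in> borel_measurable borel" and w0: "\<And>t. 0 \<le> w t" and w1: "\<And>t. t \<notin> {0..<1} \<Longrightarrow> w t = 0"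
    and iw: "integrable lborel w" and aew: "AE t in lborel. t \<in> {0..<1} \<longrightarrow> \<omega> t = w t"
    by (rule radial_weight_borel[OF rw\<omega>]) (rule that; assumption)
  have aew': "AE z in lborel. z \<in> ball (0::complex) 1 \<longrightarrow> \<omega> (cmod z) = w (cmod z)"
    by (rule AE_radial[OF aew])
  \<comment> \<open>The radial part of f \<omega>, with the Borel representative of
    \<omega>.\<close>
  define h where "h = (\<lambda>z::complex. w (cmod z) / tail \<nu> (cmod z))"
  have [measurable]: "h \<in> borel_measurable borel" unfolding h_def by measurable
  have h0: "0 \<le> h z" for z unfolding h_def using w0 tail_nonneg[OF rw] by auto
  have h1: "h z = 0" if "z \<notin> ball 0 1" for z using that w1[of "cmod z"] by (auto simp: h_def)
  \<comment> \<open>The test function without its angular factor. It lies in the space as well, and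
    integrability of f0 \<omega> gives integrability of \<open>h\<close>.\<close>
  define f0 where "f0 = (\<lambda>z::complex. complex_of_real (1 / tail \<nu> (cmod z)))"
  define f where "f = (\<lambda>z::complex. complex_of_real (Arg2pi z / tail \<nu> (cmod z)))"
  have [measurable]: "f0 \<in> borel_measurable borel" "f \<in> borel_measurable borel"
    unfolding f0_def f_def by measurable
  have tp: "0 < tail \<nu> (cmod z)" if "z \<in> ball 0 1" for z using that by (intro tail_pos rw) auto
  have f0: "f0 \<in> L_inf \<nu>"
  proof (rule weighted_norm_le(2)[OF rw, where M=1], rule measurable_lebesgue_on_borel)
    fix z :: complex assume "z \<in> ball 0 1"
    from tp[OF this] show "cmod (f0 z) * tail \<nu> (cmod z) \<le> 1" by (simp add: f0_def norm_divide)
  qed simp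
  have f: "f \<in> L_inf \<nu>"
  proof (rule weighted_norm_le(2)[OF rw, where M="2*pi"], rule measurable_lebesgue_on_borel)
    fix z :: complex assume "z \<in> ball 0 1"
    from tp[OF this] show "cmod (f z) * tail \<nu> (cmod z) \<le> 2 * pi"
      using Arg2pi[of z] by (simp add: f_def norm_divide abs_of_nonneg less_imp_le)
  qed simp
  note if0 = bounded_projection_integrable[OF rw\<omega> bd f0] and iff = bounded_projection_integrable[OF rw\<omega> bd f]
  have "integrable lborel (\<lambda>z. complex_of_real (h z))"
  proof (rule integrable_lebesgue_on_ball_iff[THEN iffD1, OF _ _ _ _ if0])
    show "AE z in lborel. z \<in> ball 0 1 \<longrightarrow> f0 z * \<omega> (cmod z) = h z"
      using aew' by eventually_elim (simp add: f0_def h_def)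
  qed (use if0 h1 in auto)
  then have ih: "integrable lborel h" by (simp only: complex_of_real_integrable_eq)
  define W where "W n = (LINT z|lborel. cmod z ^ n * h z)" for n
  have iW: "integrable lborel (\<lambda>z. cmod z ^ n * h z)" for n
  proof (rule Bochner_Integration.integrable_bound[OF ih])
    have "norm (cmod z ^ n * h z) \<le> norm (h z)" for z
    proof (cases "z \<in> ball 0 1")
      case True
      then have "cmod z ^ n * h z \<le> 1 * h z" using h0 by (intro mult_right_mono power_le_one) auto
      then show ?thesis using h0[of z] by (simp add: abs_mult)
    qed (simp add: h1)
    then show "AE z in lborel. norm (cmod z ^ n * h z) \<le> norm (h z)" by simp
  qed measurable
  define c where "c n = (LINT z|?D. f z * \<omega> (cmod z) * cnj z ^ n)" for n
  have c_eq: "c n = (LINT z|lborel. h z * (Arg2pi z * cnj z ^ n))"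
    and c_int: "integrable lborel (\<lambda>z. h z * (Arg2pi z * cnj z ^ n))" for n
  proof -
    let ?H = "\<lambda>z. h z * (Arg2pi z * cnj z ^ n)"
    have meas: "(\<lambda>z. f z * \<omega> (cmod z) * cnj z ^ n) \<in> borel_measurable ?D"
      by (rule borel_measurable_times[OF borel_measurable_integrable[OF iff] measurable_lebesgue_on_borel]) measurable
    have ae: "AE z in lborel. z \<in> ball 0 1 \<longrightarrow> f z * \<omega> (cmod z) * cnj z ^ n = ?H z"
      using aew' by eventually_elim (simp add: f_def h_def)
    show "c n = (LINT z|lborel. ?H z)" unfolding c_def
      by (rule integral_lebesgue_on_ball[OF meas _ ae]) (auto simp: h1)
    show "integrable lborel ?H"
    proof (rule integrable_lebesgue_on_ball_iff[THEN iffD1, OF meas _ ae])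
      show "integrable ?D (\<lambda>z. f z * \<omega> (cmod z) * cnj z ^ n)"
      proof (rule Bochner_Integration.integrable_bound[OF iff meas])
        have "norm (f z * \<omega> (cmod z) * cnj z ^ n) \<le> norm (f z * \<omega> (cmod z))" if "z \<in> ball 0 1" for z
        proof -
          have "cmod z ^ n \<le> 1" using that by (intro power_le_one) auto
          then show ?thesis by (simp add: norm_mult norm_power mult_left_le)
        qed
        then show "AE z in ?D. norm (f z * \<omega> (cmod z) * cnj z ^ n) \<le> norm (f z * \<omega> (cmod z))"
          by (intro AE_I2) auto
      qed
    qed (auto simp: h1)
  qed
  \<comment> \<open>\<open>h\<close> is radial, so averaging over circles replaces the angular factor by its Fourier coefficient.\<close>
  have c_pos: "c n = \<i> / n * W n" if n: "n \<ge> 1" for n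
  proof -
    have "2 * pi * c n = (LINT z|lborel. (LINT \<theta>:{0..2*pi}|lborel. h (cis \<theta> * z) * (Arg2pi (cis \<theta> * z) * cnj (cis \<theta> * z) ^ n)))"
      unfolding c_eq by (rule integral_circle_average[OF c_int, symmetric])
    also have "\<dots> = (LINT z|lborel. (LINT \<theta>:{0..2*pi}|lborel. h z * (Arg2pi (cis \<theta> * z) * cnj (cis \<theta> * z) ^ n)))"
      by (simp add: h_def norm_mult)
    also have "\<dots> = (LINT z|lborel. h z * (2 * pi * \<i> / n * cmod z ^ n))"
      by (simp only: set_integral_mult_right Fourier_Arg2pi[OF n])
    also have "\<dots> = (LINT z|lborel. 2 * pi * \<i> / n * complex_of_real (cmod z ^ n * h z))"
      by (intro Bochner_Integration.integral_cong) auto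
    also have "\<dots> = 2 * pi * (\<i> / n * W n)"
      by (simp add: W_def del: of_real_mult of_real_power)
    finally show ?thesis by (subst (asm) mult_left_cancel) auto
  qed
  \<comment> \<open>The constant coefficient may be nonzero, but it is real, and only imaginary
    parts are used below.\<close>
  have c_0: "Im (c 0) = 0"
  proof -
    have "c 0 = (LINT z|lborel. complex_of_real (h z * Arg2pi z))" by (simp add: c_eq)
    then show ?thesis by (simp only: integral_complex_of_real Im_complex_of_real)
  qed
  obtain C where C: "C > 0" "\<And>n t. 0 \<le> t \<Longrightarrow> t < 1 \<Longrightarrow> t ^ n * tail \<nu> t \<le> C * tail \<nu> (1 - 1 / (real n + 1))"
    using D_hat_power[OF \<nu>] by metis
  define T where "T n = tail \<nu> (1 - 1 / (real n + 1))" for n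
  have T: "0 < T n" for n unfolding T_def by (intro tail_pos rw) auto
  define m where "m n = moment \<omega> (2 * real n + 1)" for n
  have m: "0 < m n" for n unfolding m_def by (intro moment_pos rw\<omega>) auto
  \<comment> \<open>Here \<omega> drops out. Pointwise |z|^(2n) w = (|z|^n tail) (|z|^n h), and the
    first factor is at most C T_n by doubling of \<nu> alone, so W_n / m_n has a lower bound
    independent of \<omega>.\<close>
  have m_le: "2 * pi * m n \<le> C * T n * W n" for n
  proof -
    have W0: "0 \<le> W n" unfolding W_def by (intro Bochner_Integration.integral_nonneg) (use h0 in auto)
    have "ennreal (2 * pi * m n) = (\<integral>\<^sup>+z\<in>ball (0::complex) 1. ennreal (cmod z ^ (2 * n) * w (cmod z)) \<partial>lborel)"
      unfolding m_def by (rule moment_eq_disc_integral[OF rw\<omega> w w0 w1 iw aew])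
    also have "\<dots> \<le> (\<integral>\<^sup>+z. ennreal (C * T n * (cmod z ^ n * h z)) \<partial>lborel)"
    proof (rule nn_integral_mono)
      fix z :: complex
      show "ennreal (cmod z ^ (2 * n) * w (cmod z)) * indicator (ball 0 1) z \<le> ennreal (C * T n * (cmod z ^ n * h z))"
      proof (cases "z \<in> ball 0 1")
        case True
        have "cmod z ^ (2 * n) * w (cmod z) = (cmod z ^ n * tail \<nu> (cmod z)) * (cmod z ^ n * h z)"
          using tp[OF True] by (simp add: h_def mult_2 power_add)
        also have "\<dots> \<le> (C * T n) * (cmod z ^ n * h z)"
          using C(2)[of "cmod z" n] True h0[of z] unfolding T_def by (intro mult_right_mono) auto
        finally show ?thesis using True by (simp add: ennreal_leI)
      qed simp
    qed
    also have "\<dots> = ennreal (LINT z|lborel. C * T n * (cmod z ^ n * h z))"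
      using C(1) T[of n] h0 by (intro nn_integral_eq_integral integrable_mult_right iW) auto
    also have "(LINT z|lborel. C * T n * (cmod z ^ n * h z)) = C * T n * W n" by (simp add: W_def)
    finally show ?thesis using C(1) T[of n] W0 by (simp add: ennreal_le_iff)
  qed
  let ?P = "bergman_projection \<omega> f"
  have "?P \<in> H_inf \<nu>" using bd f by (auto simp: bergman_projection_bounded_def)
  then have P: "?P \<in> L_inf \<nu>" "?P holomorphic_on ball 0 1" by (auto simp: H_inf_def)
  obtain M where M: "M \<ge> 0" "AE z in ?D. cmod (?P z) \<le> M / tail \<nu> (cmod z)"
    using L_infE[OF rw P(1)] by metis
  \<comment> \<open>Evaluating the weight at a larger radius \<open>r\<close> turns the almost everywhere bound into one for a
    continuous function, which therefore holds at every point.\<close>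
  have P_le: "cmod (?P x) \<le> M / tail \<nu> r" if "cmod x < r" "r < 1" for x r
  proof (rule AE_le_imp_le_open[of "ball 0 r" "\<lambda>z. cmod (?P z)"])
    have sub: "ball 0 r \<subseteq> ball (0::complex) 1" using that by auto
    show "continuous_on (ball 0 r) (\<lambda>z. cmod (?P z))"
      by (intro continuous_on_norm holomorphic_on_imp_continuous_on holomorphic_on_subset[OF P(2) sub])
    show "AE z in lborel. z \<in> ball 0 r \<longrightarrow> cmod (?P z) \<le> M / tail \<nu> r"
      using M(2) unfolding AE_lebesgue_on_ball
    proof eventually_elim
      case (elim z)
      show ?case
      proof
        assume z: "z \<in> ball 0 r"
        then have "0 \<le> r" using norm_ge_zero[of z] by (simp del: norm_ge_zero)
        have "cmod (?P z) \<le> M / tail \<nu> (cmod z)" using elim z sub by auto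
        also have "\<dots> \<le> M / tail \<nu> r"
          using z that M(1) \<open>0 \<le> r\<close> by (intro divide_left_mono tail_antimono mult_pos_pos tail_pos rw) auto
        finally show "cmod (?P z) \<le> M / tail \<nu> r" .
      qed
    qed
  qed (use that in auto)
  show ?thesis
  proof (rule D_check_criterion[OF rw])
    fix x r :: real and k :: nat
    assume x: "0 \<le> x" "x < r" "r < 1"
    let ?a = "\<lambda>n. c n / (2 * pi * moment \<omega> (2 * real n + 1)) * complex_of_real x ^ n"
    have "?a sums ?P x"
      unfolding c_def using x by (intro bergman_projection_sums rw\<omega> iff) auto
    then have sums: "(\<lambda>n. Im (?a n)) sums Im (?P x)" by (rule sums_Im)
    have Im_a: "Im (?a n) = W n / (2 * pi * n * m n) * x ^ n" if "n \<ge> 1" for n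
      using that by (simp add: c_pos m_def Im_divide_of_real del: of_real_power flip: of_real_power of_real_mult of_real_divide)
    have ge: "x ^ n / (real n * T n) \<le> C * Im (?a n)" if "n \<ge> 1" for n
    proof -
      have "x ^ n / (real n * T n) = (2 * pi * m n) * (x ^ n / (real n * T n * (2 * pi * m n)))"
        using m[of n] by simp
      also have "\<dots> \<le> (C * T n * W n) * (x ^ n / (real n * T n * (2 * pi * m n)))"
        using m_le[of n] m[of n] T[of n] x by (intro mult_right_mono divide_nonneg_nonneg) (auto intro!: mult_nonneg_nonneg less_imp_le)
      also have "\<dots> = C * Im (?a n)" unfolding Im_a[OF that] using T[of n] by simp
      finally show ?thesis .
    qed
    have nn: "0 \<le> Im (?a n)" for n
    proof (cases "n = 0")
      case True then show ?thesis using c_0 by (simp flip: of_real_mult add: Im_divide_of_real)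
    next
      case False
      have "0 \<le> x ^ n / (real n * T n)" using x T[of n] by simp
      also have "\<dots> \<le> C * Im (?a n)" using False by (intro ge) auto
      finally show ?thesis using C(1) zero_le_mult_iff[of C "Im (?a n)"] by linarith
    qed
    have "(\<Sum>n\<in>{1..k}. x ^ n / (real n * T n)) \<le> (\<Sum>n\<in>{1..k}. C * Im (?a n))"
      by (intro sum_mono ge) auto
    also have "\<dots> = C * (\<Sum>n\<in>{1..k}. Im (?a n))" by (simp add: sum_distrib_left)
    \<comment> \<open>All imaginary parts are nonnegative at a real point x, so a partial sum is at
      most the full sum.\<close>
    also have "(\<Sum>n\<in>{1..k}. Im (?a n)) \<le> Im (?P x)"
      unfolding sums_unique[OF sums] by (intro sum_le_suminf sums_summable[OF sums]) (use nn in auto)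
    also have "Im (?P x) \<le> cmod (?P x)" using abs_Im_le_cmod[of "?P x"] by linarith
    also have "\<dots> \<le> M / tail \<nu> r" using x by (intro P_le) auto
    finally show "(\<Sum>n\<in>{1..k}. x ^ n / (real n * tail \<nu> (1 - 1 / (real n + 1)))) \<le> C * M / tail \<nu> r"
      using C(1) by (simp add: T_def)
  qed
qed

subsection \<open>Sufficiency\<close>

text \<open>With a natural exponent the moments are quotients of factorials and the kernel is a
  rational function.\<close>

abbreviation std_weight :: "nat \<Rightarrow> real \<Rightarrow> real" where
  "std_weight a \<equiv> \<lambda>t. (1 - t\<^sup>2) ^ a"

section \<open>Moments and kernel of the standard weights\<close>

lemma std_weight_le: "0 \<le> t \<Longrightarrow> t \<le> 1 \<Longrightarrow> 0 \<le> std_weight a t \<and> std_weight a t \<le> (1::real)"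
  using power_le_one[of t 2] by (auto intro: power_le_one)

lemma integrable_lebesgue_on_continuous:
  fixes f :: "real \<Rightarrow> real"
  assumes "continuous_on UNIV f" "0 \<le> r"
  shows "integrable (lebesgue_on {r..<1}) f"
proof -
  have "set_integrable lborel {r..1} f"
    by (intro borel_integrable_atLeastAtMost' continuous_on_subset[OF assms(1)]) auto
  then have "set_integrable lborel {r..<1} f"
    by (rule set_integrable_subset) auto
  then show ?thesis
    using borel_measurable_continuous_onI[OF assms(1)]
    by (subst integrable_restrict_space) (auto simp: set_integrable_def integrable_completion)
qed

lemma radial_weight_std: "radial_weight (std_weight a)"
  unfolding radial_weight_def
proof (intro conjI ballI)
  have cont: "continuous_on UNIV (std_weight a)" by (intro continuous_intros)
  show "integrable (lebesgue_on {0..<1}) (std_weight a)"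
    by (rule integrable_lebesgue_on_continuous[OF cont]) simp
  show "0 \<le> std_weight a r" if "r \<in> {0..<1}" for r using std_weight_le[of r a] that by auto
  fix z :: complex assume "z \<in> ball 0 1"
  define r where "r = cmod z"
  have r: "0 \<le> r" "r < 1" using \<open>z \<in> ball 0 1\<close> by (auto simp: r_def)
  \<comment> \<open>The weight decreases, so on [r, ?u] it is at least its positive value at ?u;
    this already makes the tail positive.\<close>
  let ?u = "(1 + r) / 2"
  have u: "r < ?u" "?u < 1" using r by auto
  have "?u\<^sup>2 < 1" using u r by (simp add: power_less_one_iff)
  then have c: "0 < std_weight a ?u" by simp
  have i: "integrable (lebesgue_on {r..<1}) (\<lambda>t. indicator {r..?u} t * std_weight a ?u)"
  proof -
    have "integrable lebesgue (\<lambda>t. indicator {r..?u} t * std_weight a ?u)" (is "integrable _ ?f")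
      by (subst integrable_completion, measurable)
         (intro integrable_mult_left integrable_real_indicator; simp add: emeasure_lborel_Icc_eq)
    then have "integrable lebesgue (\<lambda>t. indicator {r..<1} t *\<^sub>R ?f t)"
      by (intro integrable_mult_indicator) auto
    then show ?thesis by (subst integrable_restrict_space) auto
  qed
  have "0 < (?u - r) * std_weight a ?u" using u c by simp
  also have "\<dots> = (LINT t|lebesgue. indicator {r..?u} t * std_weight a ?u)" using u by simp
  also have "\<dots> = (LINT t|lebesgue_on {r..<1}. indicator {r..?u} t * std_weight a ?u)"
    by (subst integral_restrict_space, simp, rule Bochner_Integration.integral_cong) (use u in \<open>auto simp: indicator_def\<close>)
  also have "\<dots> \<le> (LINT t|lebesgue_on {r..<1}. std_weight a t)"
  proof (rule integral_mono[OF i integrable_lebesgue_on_continuous[OF cont r(1)]])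
    fix t assume "t \<in> space (lebesgue_on {r..<1})"
    then have t: "r \<le> t" "t < 1" by auto
    show "indicator {r..?u} t * std_weight a ?u \<le> std_weight a t"
    proof (cases "t \<le> ?u")
      case True
      then have "t\<^sup>2 \<le> ?u\<^sup>2" using r t by (intro power_mono) auto
      then have "std_weight a ?u \<le> std_weight a t" using \<open>?u\<^sup>2 < 1\<close> by (intro power_mono) linarith+
      then show ?thesis using True t by simp
    next
      case False
      then show ?thesis using std_weight_le[of t a] t r by auto
    qed
  qed
  finally show "0 < tail (std_weight a) (cmod z)" by (simp add: tail_def r_def)
qed

text \<open>This is half the Beta integral B(n+1, a+1). The induction on a uses (1 - t^2)^(a+1) = (1
  - t^2)^a - t^2 (1 - t^2)^a, which raises n and so needs n arbitrary.\<close>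

lemma has_integral_std_weight:
  "((\<lambda>t. t ^ (2 * n + 1) * std_weight a t) has_integral (fact n * fact a / (2 * fact (n + a + 1)))) {0..1}"
proof (induction a arbitrary: n)
  case 0
  have "((\<lambda>t. t ^ (2 * n + 1)) has_integral (1 ^ (2 * n + 2) / (2 * real n + 2) - 0 ^ (2 * n + 2) / (2 * real n + 2))) {0..1::real}"
  proof (rule fundamental_theorem_of_calculus)
    fix x :: real
    show "((\<lambda>t. t ^ (2 * n + 2) / (2 * real n + 2)) has_vector_derivative x ^ (2 * n + 1)) (at x within {0..1})"
      unfolding has_real_derivative_iff_has_vector_derivative[symmetric]
      by (rule derivative_eq_intros refl | simp add: add_nonneg_eq_0_iff add.commute)+
  qed simp
  moreover have "fact n * fact 0 / (2 * fact (n + 0 + 1)) = (1 / (2 * real n + 2) :: real)"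
  proof -
    have "fact n * fact 0 / (2 * fact (n + 0 + 1)) = (fact n / (fact n * (2 * real n + 2)) :: real)"
      by (simp add: algebra_simps)
    then show ?thesis by (subst (asm) nonzero_divide_mult_cancel_left) auto
  qed
  ultimately show ?case by (simp add: add.commute)
next
  case (Suc a)
  have "((\<lambda>t. t ^ (2 * n + 1) * std_weight a t - t ^ (2 * Suc n + 1) * std_weight a t) has_integral
     (fact n * fact a / (2 * fact (n + a + 1)) - fact (Suc n) * fact a / (2 * fact (Suc n + a + 1)))) {0..1}"
    by (intro has_integral_diff Suc.IH)
  also have "(\<lambda>t::real. t ^ (2 * n + 1) * std_weight a t - t ^ (2 * Suc n + 1) * std_weight a t) =
      (\<lambda>t. t ^ (2 * n + 1) * std_weight (Suc a) t)"
    by (auto simp: algebra_simps power2_eq_square)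
  also have "fact n * fact a / (2 * fact (n + a + 1)) - fact (Suc n) * fact a / (2 * fact (Suc n + a + 1)) =
      (fact n * fact (Suc a) / (2 * fact (n + Suc a + 1)) :: real)"
  proof -
    define G x :: real where "G = fact (n + a + 1)" and "x = fact n * fact a"
    have G: "G \<noteq> 0" unfolding G_def by (rule fact_nonzero)
    have *: "x / (2 * G) - N * x / (2 * (K * G)) = (K - N) * x / (2 * (K * G))"
      if "K \<noteq> 0" for N K :: real
      using that G by (simp add: field_simps)
    have facts: "fact (Suc n + a + 1) = ((real n + 1) + (real a + 1)) * G" "fact (n + Suc a + 1) = ((real n + 1) + (real a + 1)) * G"
      "fact (Suc n) * fact a = (real n + 1) * x" "fact n * fact (Suc a) = (real a + 1) * x"
      unfolding G_def x_def by (simp_all add: algebra_simps)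
    show ?thesis
      unfolding facts G_def[symmetric] x_def[symmetric] by (subst *, linarith) simp
  qed
  finally show ?case .
qed

lemma moment_std_weight: "2 * moment (std_weight a) (2 * real n + 1) = fact n * fact a / fact (n + a + 1)"
proof -
  let ?f = "\<lambda>t::real. t ^ (2 * n + 1) * std_weight a t"
  have cont: "continuous_on {0..1} ?f" by (intro continuous_intros)
  have [measurable]: "?f \<in> borel_measurable borel" by measurable
  have int: "set_integrable lborel {0..1} ?f"
    by (intro borel_integrable_atLeastAtMost' cont)
  have powr: "r powr (2 * real n + 1) = r ^ (2 * n + 1)" if "0 \<le> r" for r :: real
    using that powr_realpow'[of r "2 * n + 1"] by (simp add: add.commute)
  have "moment (std_weight a) (2 * real n + 1) = (LINT t|lebesgue_on {0..<1}. ?f t)"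
    unfolding moment_def by (intro Bochner_Integration.integral_cong) (auto simp: powr)
  also have "\<dots> = (LINT t|lebesgue. indicator {0..<1} t *\<^sub>R ?f t)"
    by (subst integral_restrict_space) auto
  also have "\<dots> = (LINT t|lborel. indicator {0..<1} t *\<^sub>R ?f t)"
    by (rule integral_completion) measurable
  also have "\<dots> = (LINT t:{0..1}|lborel. ?f t)"
    unfolding set_lebesgue_integral_def
    by (rule integral_cong_AE, measurable, use AE_lborel_singleton[of "1::real"] in eventually_elim) (auto simp: indicator_def)
  also have "\<dots> = integral {0..1} ?f" by (rule set_borel_integral_eq_integral(2)[OF int])
  also have "\<dots> = fact n * fact a / (2 * fact (n + a + 1))"
    by (rule integral_unique[OF has_integral_std_weight])
  finally show ?thesis by simp
qed

text \<open>The reciprocal of n! a! / (n+a+1)! is (a+1) times the binomial coefficient of n+a+1 over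
  n, so the kernel is the negative binomial series of exponent a + 2.\<close>

lemma bergman_kernel_std_weight:
  assumes "cmod (cnj z * \<zeta>) < 1"
  shows "bergman_kernel (std_weight a) z \<zeta> = of_nat (a + 1) / (1 - cnj z * \<zeta>) ^ (a + 2)"
proof -
  let ?w = "cnj z * \<zeta>"
  have coeff: "1 / complex_of_real (2 * moment (std_weight a) (2 * real n + 1)) = (a + 1) * of_nat ((n + a + 1) choose n)" for n
  proof -
    define F :: real where "F = fact (n + a + 1)"
    have F: "F \<noteq> 0" by (simp add: F_def del: fact_Suc)
    have "real ((n + a + 1) choose n) = fact (n + a + 1) / (fact n * fact (a + 1))"
      using binomial_fact[of n "n + a + 1", where 'a=real] by simp
    also have "\<dots> = F / (fact n * ((real a + 1) * fact a))"
      unfolding F_def by (simp add: add_ac)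
    finally have choose: "real ((n + a + 1) choose n) = F / (fact n * ((real a + 1) * fact a))" .
    have cancel: "A * (F / (x * (A * y))) = F / (x * y)" if "A \<noteq> 0" for A x y :: real
      using that by simp
    have "1 / (2 * moment (std_weight a) (2 * real n + 1)) = (real a + 1) * real ((n + a + 1) choose n)"
      unfolding moment_std_weight F_def[symmetric] choose by (subst cancel) simp_all
    then have "complex_of_real (1 / (2 * moment (std_weight a) (2 * real n + 1))) = complex_of_real ((real a + 1) * real ((n + a + 1) choose n))"
      by (simp only:)
    then show ?thesis by (simp add: distrib_right)
  qed
  have gb: "(- of_nat (a + 2) gchoose n) * (- ?w) ^ n = of_nat ((n + a + 1) choose n) * ?w ^ n" for n
  proof -
    have "(- of_nat (a + 2) gchoose n :: complex) = (-1) ^ n * (of_nat (n + a + 1) gchoose n)"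
      by (subst gbinomial_minus) (simp add: algebra_simps)
    then have "(- of_nat (a + 2) gchoose n) * (- ?w) ^ n = ((-1) ^ n * of_nat ((n + a + 1) choose n)) * ((-1) ^ n * ?w ^ n)"
      unfolding binomial_gbinomial power_minus[of ?w n] by (simp only:)
    also have "\<dots> = ((-1) ^ n * (-1) ^ n) * (of_nat ((n + a + 1) choose n) * ?w ^ n)"
      by (simp only: mult_ac)
    also have "(-1) ^ n * (-1) ^ n = (1::complex)"
      by (simp flip: power_mult_distrib)
    finally show ?thesis by simp
  qed
  have "(\<lambda>n. (- of_nat (a + 2) gchoose n) * (- ?w) ^ n) sums (1 + - ?w) powr (- of_nat (a + 2))"
    by (rule gen_binomial_complex) (use assms in simp)
  also have "(1 + - ?w) powr (- of_nat (a + 2)) = 1 / (1 - ?w) ^ (a + 2)"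
    using powr_nat'[of "1 - ?w" "a + 2"] by (simp only: powr_minus inverse_eq_divide) simp
  finally have "(\<lambda>n. of_nat ((n + a + 1) choose n) * ?w ^ n) sums (1 / (1 - ?w) ^ (a + 2))"
    unfolding gb .
  from sums_mult[OF this, of "of_nat (a + 1)"]
  have *: "(\<lambda>n. of_nat (a + 1) * (of_nat ((n + a + 1) choose n) * ?w ^ n)) sums (of_nat (a + 1) * (1 / (1 - ?w) ^ (a + 2)))" .
  have "?w ^ n / complex_of_real (2 * moment (std_weight a) (2 * real n + 1)) =
      of_nat (a + 1) * (of_nat ((n + a + 1) choose n) * ?w ^ n)" for n
  proof -
    have "?w ^ n / complex_of_real (2 * moment (std_weight a) (2 * real n + 1)) =
        1 / complex_of_real (2 * moment (std_weight a) (2 * real n + 1)) * ?w ^ n"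
      by simp
    then show ?thesis unfolding coeff by (simp only: of_nat_mult of_nat_id mult.assoc)
  qed
  then show ?thesis
    unfolding bergman_kernel_def using sums_unique[OF *] by (simp add: add.commute)
qed

section \<open>The Poisson kernel and radial integration\<close>

lemma Re_Cayley: "Re ((1 + u) / (1 - u)) = (1 - cmod u ^ 2) / cmod (1 - u) ^ 2"
proof -
  have "Re ((1 + u) / (1 - u)) = Re ((1 + u) * cnj (1 - u)) / cmod (1 - u) ^ 2"
    by (subst complex_div_cnj) (simp only: Re_divide_of_real flip: of_real_power)
  also have "Re ((1 + u) * cnj (1 - u)) = 1 - cmod u ^ 2"
    by (simp add: cmod_power2) (simp add: algebra_simps power2_eq_square)
  finally show ?thesis .
qed

text \<open>The Poisson kernel is the real part of (1+u)/(1-u) = 1 + 2u/(1-u) with u = exp(i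
  \<theta>) w, which has an explicit primitive in \<theta>.\<close>

lemma nn_integral_Poisson:
  assumes w: "cmod w < 1"
  shows "(\<integral>\<^sup>+\<theta>\<in>{0..2*pi}. ennreal ((1 - cmod w ^ 2) / cmod (1 - cis \<theta> * w) ^ 2) \<partial>lborel) = ennreal (2 * pi)"
proof -
  \<comment> \<open>Since du/d\<theta> = i u, the derivative of i Ln(1-u) is u/(1-u). The principal
    branch is safe because Re(1-u) > 0, and the logarithm is periodic, so only the summand s
    contributes 2 \<pi>.\<close>
  define G where "G = (\<lambda>s. s + 2 * \<i> * Ln (1 - exp (\<i> * s) * w))"
  have norm: "cmod (cis \<theta> * w) < 1" for \<theta> using w by (simp add: norm_mult)
  have nz: "1 - cis \<theta> * w \<noteq> 0" for \<theta> using norm[of \<theta>] by auto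
  have Re_pos: "0 < Re (1 - cis \<theta> * w)" for \<theta>
    using norm[of \<theta>] complex_Re_le_cmod[of "cis \<theta> * w"] by (simp only: minus_complex.sel one_complex.sel)
  have deriv: "((\<lambda>\<theta>. Re (G (complex_of_real \<theta>))) has_real_derivative ((1 - cmod w ^ 2) / cmod (1 - cis \<theta> * w) ^ 2)) (at \<theta>)" for \<theta>
  proof -
    let ?u = "cis \<theta> * w"
    have exp: "exp (\<i> * complex_of_real \<theta>) = cis \<theta>" by (simp add: cis_conv_exp)
    have "1 - exp (\<i> * complex_of_real \<theta>) * w \<notin> \<real>\<^sub>\<le>\<^sub>0"
      using Re_pos[of \<theta>] unfolding exp by (auto simp: complex_nonpos_Reals_iff)
    then have "(G has_field_derivative 1 + 2 * \<i> * (- (\<i> * exp (\<i> * complex_of_real \<theta>) * w) / (1 - exp (\<i> * complex_of_real \<theta>) * w))) (at (complex_of_real \<theta>))"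
      unfolding G_def by (auto intro!: derivative_eq_intros simp: divide_inverse mult_ac)
    also have "1 + 2 * \<i> * (- (\<i> * exp (\<i> * complex_of_real \<theta>) * w) / (1 - exp (\<i> * complex_of_real \<theta>) * w)) = (1 + ?u) / (1 - ?u)"
      unfolding exp using nz[of \<theta>] by (simp add: field_simps)
    finally have "((\<lambda>\<theta>. G (complex_of_real \<theta>)) has_vector_derivative ((1 + ?u) / (1 - ?u))) (at \<theta>)"
      by (rule has_vector_derivative_real_field)
    from bounded_linear.has_vector_derivative[OF bounded_linear_Re this]
    have "((\<lambda>\<theta>. Re (G (complex_of_real \<theta>))) has_real_derivative Re ((1 + ?u) / (1 - ?u))) (at \<theta>)"
      by (simp add: has_real_derivative_iff_has_vector_derivative)
    also have "Re ((1 + ?u) / (1 - ?u)) = (1 - cmod ?u ^ 2) / cmod (1 - ?u) ^ 2"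
      by (rule Re_Cayley)
    finally show ?thesis by (simp add: norm_mult)
  qed
  have [measurable]: "(\<lambda>\<theta>. (1 - cmod w ^ 2) / cmod (1 - cis \<theta> * w) ^ 2) \<in> borel_measurable borel" by measurable
  have "(\<integral>\<^sup>+\<theta>\<in>{0..2*pi}. ennreal ((1 - cmod w ^ 2) / cmod (1 - cis \<theta> * w) ^ 2) \<partial>lborel) =
      ennreal (Re (G (complex_of_real (2 * pi))) - Re (G (complex_of_real 0)))"
    by (rule nn_integral_FTC_Icc) (use w deriv in \<open>auto simp: abs_square_le_1 power_le_one less_imp_le intro!: divide_nonneg_nonneg\<close>)
  also have "Re (G (complex_of_real (2 * pi))) - Re (G (complex_of_real 0)) = 2 * pi"
    by (simp add: G_def exp_two_pi_i mult_ac)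
  finally show ?thesis .
qed

text \<open>Averaging over circles affects only the squared modulus in the denominator, which the
  Poisson integral turns into 1 - (|z| t)^2; what remains is radial.\<close>

lemma nn_integral_disc_Poisson:
  fixes g :: "real \<Rightarrow> real"
  assumes [measurable]: "g \<in> borel_measurable borel" and g: "\<And>t. 0 \<le> t \<Longrightarrow> t < 1 \<Longrightarrow> 0 \<le> g t" and z: "cmod z < 1"
  shows "(\<integral>\<^sup>+\<zeta>\<in>ball 0 1. ennreal (g (cmod \<zeta>) / cmod (1 - cnj z * \<zeta>) ^ 2) \<partial>lborel) =
     (\<integral>\<^sup>+t\<in>{0..<1}. ennreal (2 * pi * t) * ennreal (g t / (1 - (cmod z * t) ^ 2)) \<partial>lborel)"
proof -
  have [measurable]: "ball (0::complex) 1 \<in> sets borel" by simp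
  let ?F = "\<lambda>\<zeta>. ennreal (g (cmod \<zeta>) / cmod (1 - cnj z * \<zeta>) ^ 2) * indicator (ball 0 1) \<zeta>"
  let ?H = "\<lambda>\<zeta>. ennreal (g (cmod \<zeta>) / (1 - (cmod z * cmod \<zeta>) ^ 2)) * indicator (ball (0::complex) 1) \<zeta>"
  have "ennreal (2 * pi) * (\<integral>\<^sup>+\<zeta>. ?F \<zeta> \<partial>lborel) = (\<integral>\<^sup>+\<zeta>. (\<integral>\<^sup>+\<theta>\<in>{0..2*pi}. ?F (cis \<theta> * \<zeta>) \<partial>lborel) \<partial>lborel)"
    by (rule nn_integral_circle_average[symmetric]) measurable
  also have "\<dots> = (\<integral>\<^sup>+\<zeta>. ?H \<zeta> * ennreal (2 * pi) \<partial>lborel)"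
  proof (rule nn_integral_cong)
    fix \<zeta> :: complex
    show "(\<integral>\<^sup>+\<theta>\<in>{0..2*pi}. ?F (cis \<theta> * \<zeta>) \<partial>lborel) = ?H \<zeta> * ennreal (2 * pi)"
    proof (cases "\<zeta> \<in> ball 0 1")
      case True
      let ?w = "cnj z * \<zeta>"
      have w: "cmod ?w = cmod z * cmod \<zeta>" "cmod ?w < 1"
        using True z mult_strict_mono'[of "cmod z" 1 "cmod \<zeta>" 1] by (auto simp: norm_mult)
      have "cmod ?w ^ 2 < 1" using w(2) by (simp add: power_less_one_iff)
      then have d: "0 < 1 - (cmod z * cmod \<zeta>) ^ 2" unfolding w(1)[symmetric] by simp
      have g0: "0 \<le> g (cmod \<zeta>)" using g True by auto
      have "(\<integral>\<^sup>+\<theta>\<in>{0..2*pi}. ?F (cis \<theta> * \<zeta>) \<partial>lborel) =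
        (\<integral>\<^sup>+\<theta>. ?H \<zeta> * (ennreal ((1 - cmod ?w ^ 2) / cmod (1 - cis \<theta> * ?w) ^ 2) * indicator {0..2*pi} \<theta>) \<partial>lborel)"
      proof (rule nn_integral_cong)
        fix \<theta>
        have c: "cnj z * (cis \<theta> * \<zeta>) = cis \<theta> * ?w" by (simp add: mult_ac)
        have "g (cmod \<zeta>) / cmod (1 - cis \<theta> * ?w) ^ 2 =
          g (cmod \<zeta>) / (1 - (cmod z * cmod \<zeta>) ^ 2) * ((1 - cmod ?w ^ 2) / cmod (1 - cis \<theta> * ?w) ^ 2)"
          using d unfolding w(1) by simp
        then have "ennreal (g (cmod \<zeta>) / cmod (1 - cis \<theta> * ?w) ^ 2) =
          ennreal (g (cmod \<zeta>) / (1 - (cmod z * cmod \<zeta>) ^ 2)) * ennreal ((1 - cmod ?w ^ 2) / cmod (1 - cis \<theta> * ?w) ^ 2)"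
          using d g0 unfolding w(1) by (subst ennreal_mult[symmetric]) (simp_all add: less_imp_le)
        then show "?F (cis \<theta> * \<zeta>) * indicator {0..2*pi} \<theta> =
          ?H \<zeta> * (ennreal ((1 - cmod ?w ^ 2) / cmod (1 - cis \<theta> * ?w) ^ 2) * indicator {0..2*pi} \<theta>)"
          unfolding c using True by (simp add: norm_mult mult.assoc)
      qed
      also have "\<dots> = ?H \<zeta> * (\<integral>\<^sup>+\<theta>\<in>{0..2*pi}. ennreal ((1 - cmod ?w ^ 2) / cmod (1 - cis \<theta> * ?w) ^ 2) \<partial>lborel)"
        by (rule nn_integral_cmult) measurable
      finally show ?thesis unfolding nn_integral_Poisson[OF w(2)] .
    qed (simp add: norm_mult)
  qed
  also have "\<dots> = ennreal (2 * pi) * (\<integral>\<^sup>+\<zeta>. ?H \<zeta> \<partial>lborel)"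
    by (subst nn_integral_multc) (simp_all add: mult.commute)
  finally have "(\<integral>\<^sup>+\<zeta>. ?F \<zeta> \<partial>lborel) = (\<integral>\<^sup>+\<zeta>. ?H \<zeta> \<partial>lborel)"
    by (subst (asm) ennreal_mult_cancel_left) auto
  also have "\<dots> = (\<integral>\<^sup>+t\<in>{0..<1}. ennreal (2 * pi * t) * ennreal (g t / (1 - (cmod z * t) ^ 2)) \<partial>lborel)"
    by (rule nn_integral_disc_radial) measurable
  finally show ?thesis .
qed

text \<open>The function 1/tail is reproduced, up to a constant, by the operator with kernel |B|
  \<omega>; this is the L-infinity bound for the absolute kernel. Growth exponent and weight
  exponent are the same \<open>a\<close>, which produces the exact cancellation above |z|.\<close>

lemma kernel_integral_bound:
  assumes rw: "radial_weight \<nu>"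
    and growth: "\<And>r t. 0 \<le> r \<Longrightarrow> r \<le> t \<Longrightarrow> t < 1 \<Longrightarrow> tail \<nu> r \<le> (2 * ((1 - r) / (1 - t))) ^ a * tail \<nu> t"
    and A: "A > 0" and \<gamma>: "\<gamma> > 0"
    and decay: "\<And>r t. 0 \<le> r \<Longrightarrow> r \<le> t \<Longrightarrow> t < 1 \<Longrightarrow> tail \<nu> t \<le> A * ((1 - t) / (1 - r)) powr \<gamma> * tail \<nu> r"
  shows "\<exists>K\<ge>0. \<forall>z\<in>ball 0 1.
    (\<integral>\<^sup>+\<zeta>\<in>ball 0 1. ennreal (cmod (of_nat (a + 1) / (1 - cnj z * \<zeta>) ^ (a + 2)) * std_weight a (cmod \<zeta>) / tail \<nu> (cmod \<zeta>)) \<partial>lborel)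
      \<le> ennreal (K / tail \<nu> (cmod z))"
proof -
  note [measurable] = measurable_tail_max[OF rw]
  \<comment> \<open>a + 1 comes from the kernel, the first 2^a from 1 - t^2 \<le> 2 (1 - t), 2 \<pi>
    from the Jacobian, A / \<gamma> from radii below |z| and the last 2^a from radii above.\<close>
  define K where "K = (real a + 1) * 2 ^ a * (2 * pi * (A / \<gamma> + 2 ^ a))"
  have tm: "tail \<nu> (max 0 t) = tail \<nu> t" if "0 \<le> t" for t using that by (simp add: max_def)
  have tp: "0 < tail \<nu> t" if "0 \<le> t" "t < 1" for t using that by (rule tail_pos[OF rw])
  show ?thesis
  proof (intro exI[of _ K] conjI ballI)
    show "K \<ge> 0" using A \<gamma> by (auto simp: K_def intro!: mult_nonneg_nonneg add_nonneg_nonneg)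
    fix z :: complex assume "z \<in> ball 0 1"
    define r where "r = cmod z"
    have r: "0 \<le> r" "r < 1" using \<open>z \<in> ball 0 1\<close> by (auto simp: r_def)
    \<comment> \<open>The radial majorant left after a of the a + 2 factors of the kernel have been
      bounded through |1 - w| \<ge> 1 - r t; the other two form the Poisson kernel.
      \<open>max 0\<close> only secures measurability on the whole line.\<close>
    define g where "g t = (real a + 1) * 2 ^ a * ((1 - t) ^ a / ((1 - r * t) ^ a * tail \<nu> (max 0 t)))" for t
    have [measurable]: "g \<in> borel_measurable borel" unfolding g_def by measurable
    have rt: "0 < 1 - r * t" "1 - t \<le> 1 - r * t" "1 - r \<le> 1 - r * t" if "0 \<le> t" "t < 1" for t
      using r that mult_left_mono[of t 1 r] mult_right_mono[of r 1 t] by auto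
    have g0: "0 \<le> g t" if "0 \<le> t" "t < 1" for t
      using rt[OF that] tp[OF that] that by (auto simp: g_def intro!: mult_nonneg_nonneg divide_nonneg_nonneg)
    have "(\<integral>\<^sup>+\<zeta>\<in>ball 0 1. ennreal (cmod (of_nat (a + 1) / (1 - cnj z * \<zeta>) ^ (a + 2)) * std_weight a (cmod \<zeta>) / tail \<nu> (cmod \<zeta>)) \<partial>lborel)
      \<le> (\<integral>\<^sup>+\<zeta>\<in>ball 0 1. ennreal (g (cmod \<zeta>) / cmod (1 - cnj z * \<zeta>) ^ 2) \<partial>lborel)"
    proof (rule nn_integral_mono)
      fix \<zeta> :: complex
      show "ennreal (cmod (of_nat (a + 1) / (1 - cnj z * \<zeta>) ^ (a + 2)) * std_weight a (cmod \<zeta>) / tail \<nu> (cmod \<zeta>)) * indicator (ball 0 1) \<zeta>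
         \<le> ennreal (g (cmod \<zeta>) / cmod (1 - cnj z * \<zeta>) ^ 2) * indicator (ball 0 1) \<zeta>"
      proof (cases "\<zeta> \<in> ball 0 1")
        case True
        define t where "t = cmod \<zeta>"
        define d where "d = cmod (1 - cnj z * \<zeta>)"
        have t: "0 \<le> t" "t < 1" using True by (auto simp: t_def)
        have d: "1 - r * t \<le> d"
          using norm_triangle_ineq2[of 1 "cnj z * \<zeta>"] by (simp add: d_def r_def t_def norm_mult)
        note rt = rt[OF t] and tp = tp[OF t]
        have "(1 - t\<^sup>2) ^ a \<le> (2 * (1 - t)) ^ a"
        proof (rule power_mono)
          have "(1 - t) * (1 + t) \<le> (1 - t) * 2" using t by (intro mult_left_mono) auto
          then show "1 - t\<^sup>2 \<le> 2 * (1 - t)" by (simp add: algebra_simps power2_eq_square)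
        qed (use t in \<open>simp add: power_le_one\<close>)
        then have w: "(1 - t\<^sup>2) ^ a \<le> 2 ^ a * (1 - t) ^ a" by (simp only: power_mult_distrib)
        have da: "(1 - r * t) ^ a \<le> d ^ a" using d rt by (intro power_mono) auto
        have dp: "0 < d" using d rt by linarith
        have "cmod (of_nat (a + 1) / (1 - cnj z * \<zeta>) ^ (a + 2)) * std_weight a t / tail \<nu> t =
           (real a + 1) * (1 - t\<^sup>2) ^ a / (d ^ a * tail \<nu> t * d ^ 2)"
        proof -
          have "cmod (of_nat (a + 1)) = real a + 1" unfolding norm_of_nat by simp
          then show ?thesis unfolding norm_divide norm_power d_def[symmetric] power_add[of d] by simp
        qed
        also have "\<dots> \<le> (real a + 1) * (2 ^ a * (1 - t) ^ a) / ((1 - r * t) ^ a * tail \<nu> t * d ^ 2)"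
          using w da dp rt tp t by (intro frac_le mult_left_mono mult_right_mono mult_pos_pos mult_nonneg_nonneg) auto
        also have "\<dots> = g t / d ^ 2"
          using t by (simp add: g_def tm)
        finally have "ennreal (cmod (of_nat (a + 1) / (1 - cnj z * \<zeta>) ^ (a + 2)) * std_weight a t / tail \<nu> t) \<le> ennreal (g t / d ^ 2)"
          by (rule ennreal_leI)
        then show ?thesis unfolding t_def d_def indicator_simps(1)[OF True] mult_1_right .
      qed simp
    qed
    also have "\<dots> = (\<integral>\<^sup>+t\<in>{0..<1}. ennreal (2 * pi * t) * ennreal (g t / (1 - (r * t) ^ 2)) \<partial>lborel)"
      using r g0 unfolding r_def by (intro nn_integral_disc_Poisson) auto
    \<comment> \<open>Split at r = |z|. Both closed intervals contain r, which is harmless for an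
      upper bound.\<close>
    also have "\<dots> \<le> (\<integral>\<^sup>+t. ennreal ((real a + 1) * 2 ^ a * (2 * pi / tail \<nu> r) * (A * (1 - r) powr \<gamma>) * (1 - t) powr (- \<gamma> - 1)) * indicator {0..r} t
        + ennreal ((real a + 1) * 2 ^ a * (2 * pi / tail \<nu> r) * (2 ^ a / (1 - r))) * indicator {r..1} t \<partial>lborel)"
      (is "_ \<le> (\<integral>\<^sup>+t. ?I t + ?J t \<partial>lborel)")
    proof (rule nn_integral_mono)
      fix t :: real
      show "ennreal (2 * pi * t) * ennreal (g t / (1 - (r * t) ^ 2)) * indicator {0..<1} t \<le> ?I t + ?J t"
      proof (cases "t \<in> {0..<1}")
        case True
        then have t: "0 \<le> t" "t < 1" by auto
        note rt = rt[OF t]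
        let ?c = "(real a + 1) * 2 ^ a"
        have "(r * t)\<^sup>2 \<le> r * t" using r t rt(1) by (auto simp: power2_eq_square intro!: mult_left_le)
        then have "g t / (1 - (r * t) ^ 2) \<le> g t / (1 - r * t)"
          using g0[OF t] rt by (intro divide_left_mono mult_pos_pos) auto
        also have "\<dots> = ?c * ((1 - t) ^ a / ((1 - r * t) ^ (a + 1) * tail \<nu> t))"
          using t by (simp add: g_def tm)
        finally have gle: "g t / (1 - (r * t) ^ 2) \<le> ?c * ((1 - t) ^ a / ((1 - r * t) ^ (a + 1) * tail \<nu> t))" .
        have g00: "0 \<le> g t / (1 - (r * t)\<^sup>2)"
          using g0[OF t] \<open>(r * t)\<^sup>2 \<le> r * t\<close> rt(1) by (intro divide_nonneg_nonneg) auto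
        have "2 * pi * t * (g t / (1 - (r * t) ^ 2)) \<le> 2 * pi * 1 * (?c * ((1 - t) ^ a / ((1 - r * t) ^ (a + 1) * tail \<nu> t)))"
          using t g00 by (intro mult_mono gle mult_left_mono) auto
        also have "\<dots> = ?c * 2 * pi * ((1 - t) ^ a / ((1 - r * t) ^ (a + 1) * tail \<nu> t))" by (simp only: mult_ac mult_1_right mult_1)
        finally have "ennreal (2 * pi * t * (g t / (1 - (r * t) ^ 2))) \<le>
          ennreal (?c * 2 * pi * ((1 - t) ^ a / ((1 - r * t) ^ (a + 1) * tail \<nu> t)))"
          by (rule ennreal_leI)
        moreover have "ennreal (2 * pi * t * (g t / (1 - (r * t) ^ 2))) = ennreal (2 * pi * t) * ennreal (g t / (1 - (r * t) ^ 2))"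
          using t g00 by (intro ennreal_mult) simp_all
        ultimately have le: "ennreal (2 * pi * t) * ennreal (g t / (1 - (r * t) ^ 2)) * indicator {0..<1} t \<le>
          ennreal (?c * 2 * pi * ((1 - t) ^ a / ((1 - r * t) ^ (a + 1) * tail \<nu> t)))"
          using True by simp
        note tr = tp[OF r] tp[OF t]
        show ?thesis
        proof (cases "t \<le> r")
          case True
          \<comment> \<open>Below r, the size of 1 - r t is that of 1 - t: the powers cancel down to
            1/(1-t), and the decay from t to r supplies the extra negative power \<gamma>.\<close>
          have "(1 - t) ^ a / ((1 - r * t) ^ (a + 1) * tail \<nu> t) \<le> (1 - t) ^ a / ((1 - t) ^ (a + 1) * tail \<nu> t)"
            using rt t tr by (intro divide_left_mono mult_right_mono power_mono mult_pos_pos) auto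
          also have "\<dots> = 1 / (1 - t) * (1 / tail \<nu> t)" using t by simp
          also have "\<dots> \<le> 1 / (1 - t) * ((A * ((1 - r) / (1 - t)) powr \<gamma>) / tail \<nu> r)"
            using decay[of t r] True t r tr by (intro mult_left_mono) (simp_all add: field_simps)
          also have "\<dots> =
            1 / tail \<nu> r * (A * (1 - r) powr \<gamma>) * (1 - t) powr (- \<gamma> - 1)"
            using t r by (simp add: powr_divide powr_diff powr_minus field_simps)
          finally have "?c * 2 * pi * ((1 - t) ^ a / ((1 - r * t) ^ (a + 1) * tail \<nu> t)) \<le>
            ?c * 2 * pi * (1 / tail \<nu> r * (A * (1 - r) powr \<gamma>) * (1 - t) powr (- \<gamma> - 1))"
            using t by (intro mult_left_mono) auto
          also have "\<dots> = ?c * (2 * pi / tail \<nu> r) * (A * (1 - r) powr \<gamma>) * (1 - t) powr (- \<gamma> - 1)" by simp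
          finally have "ennreal (?c * 2 * pi * ((1 - t) ^ a / ((1 - r * t) ^ (a + 1) * tail \<nu> t))) \<le> ?I t"
            using True t by (simp add: ennreal_leI)
          also have "\<dots> \<le> ?I t + ?J t" by simp
          finally show ?thesis by (rule order_trans[OF le])
        next
          case False
          \<comment> \<open>Above r, 1 - r t is replaced by 1 - r. The growth bound contributes
            (1-t)^(-a), which (1-t)^a cancels, leaving a constant of order 1/(1-r) on an interval of
            length 1 - r.\<close>
          have "1 / tail \<nu> t \<le> (2 * ((1 - r) / (1 - t))) ^ a / tail \<nu> r"
            using growth[of r t] False t r tr by (simp add: field_simps)
          then have "(1 - t) ^ a / (1 - r * t) ^ (a + 1) * (1 / tail \<nu> t) \<le> (1 - t) ^ a / (1 - r) ^ (a + 1) * ((2 * ((1 - r) / (1 - t))) ^ a / tail \<nu> r)"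
            using rt t r tr by (intro mult_mono divide_left_mono power_mono mult_pos_pos) auto
          also have "\<dots> = 2 ^ a / (1 - r) / tail \<nu> r"
          proof -
            have "u ^ a / v ^ (a + 1) * ((2 * (v / u)) ^ a / T) = 2 ^ a / v / T" if "u \<noteq> 0" "v \<noteq> 0" for u v T :: real
              using that by (simp add: power_mult_distrib power_divide)
            from this[of "1 - t" "1 - r" "tail \<nu> r"] show ?thesis using t r by linarith
          qed
          finally have "?c * 2 * pi * ((1 - t) ^ a / ((1 - r * t) ^ (a + 1) * tail \<nu> t)) \<le> ?c * 2 * pi * (2 ^ a / (1 - r) / tail \<nu> r)"
            by (intro mult_left_mono) auto
          also have "\<dots> = ?c * (2 * pi / tail \<nu> r) * (2 ^ a / (1 - r))" by (simp add: mult.commute)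
          finally have "ennreal (?c * 2 * pi * ((1 - t) ^ a / ((1 - r * t) ^ (a + 1) * tail \<nu> t))) \<le> ?J t"
            using False t by (simp add: ennreal_leI)
          also have "\<dots> \<le> ?I t + ?J t" by simp
          finally show ?thesis by (rule order_trans[OF le])
        qed
      qed simp
    qed
    also have "\<dots> = (\<integral>\<^sup>+t. ?I t \<partial>lborel) + (\<integral>\<^sup>+t. ?J t \<partial>lborel)"
      by (rule nn_integral_add) measurable
    also have "\<dots> \<le> ennreal ((real a + 1) * 2 ^ a * (2 * pi / tail \<nu> r) * (A / \<gamma>)) + ennreal ((real a + 1) * 2 ^ a * (2 * pi / tail \<nu> r) * 2 ^ a)"
    proof (rule add_mono)
    show "(\<integral>\<^sup>+t. ?J t \<partial>lborel) \<le> ennreal ((real a + 1) * 2 ^ a * (2 * pi / tail \<nu> r) * 2 ^ a)"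
    proof -
      let ?c = "(real a + 1) * 2 ^ a * (2 * pi / tail \<nu> r)"
      have "(\<integral>\<^sup>+t. ?J t \<partial>lborel) = ennreal (?c * (2 ^ a / (1 - r))) * ennreal (1 - r)"
        using r by (subst nn_integral_cmult_indicator) simp_all
      also have "\<dots> = ennreal (?c * (2 ^ a / (1 - r)) * (1 - r))"
        using r tp[OF r] by (intro ennreal_mult[symmetric]) simp_all
      also have "?c * (2 ^ a / (1 - r)) * (1 - r) = ?c * 2 ^ a" using r by simp
      finally show ?thesis by simp
    qed
    show "(\<integral>\<^sup>+t. ?I t \<partial>lborel) \<le> ennreal ((real a + 1) * 2 ^ a * (2 * pi / tail \<nu> r) * (A / \<gamma>))"
    proof -
      let ?c = "(real a + 1) * 2 ^ a * (2 * pi / tail \<nu> r)"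
      have c: "0 \<le> ?c" using tp[OF r] by simp
      have "(\<integral>\<^sup>+t. ?I t \<partial>lborel) = ennreal (?c * (A * (1 - r) powr \<gamma>) * ((1 - r) powr (- \<gamma>) / \<gamma>) - ?c * (A * (1 - r) powr \<gamma>) * ((1 - 0) powr (- \<gamma>) / \<gamma>))"
      proof (rule nn_integral_FTC_Icc[where f="\<lambda>t. ?c * (A * (1 - r) powr \<gamma>) * (1 - t) powr (- \<gamma> - 1)"
          and F="\<lambda>t. ?c * (A * (1 - r) powr \<gamma>) * ((1 - t) powr (- \<gamma>) / \<gamma>)"])
        fix t assume "t \<in> {0..r}"
        then have "((\<lambda>t. (1 - t) powr (- \<gamma>) / \<gamma>) has_real_derivative (1 - t) powr (- \<gamma> - 1)) (at t)"
          using r \<gamma> by (auto intro!: derivative_eq_intros simp: field_simps powr_diff)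
        from DERIV_cmult[OF this]
        show "((\<lambda>t. ?c * (A * (1 - r) powr \<gamma>) * ((1 - t) powr (- \<gamma>) / \<gamma>)) has_real_derivative
          ?c * (A * (1 - r) powr \<gamma>) * (1 - t) powr (- \<gamma> - 1)) (at t)" .
        show "0 \<le> ?c * (A * (1 - r) powr \<gamma>) * (1 - t) powr (- \<gamma> - 1)"
          using A tp[OF r] by (intro mult_nonneg_nonneg) auto
      qed (use r in auto)
      also have "\<dots> \<le> ennreal (?c * (A * (1 - r) powr \<gamma>) * ((1 - r) powr (- \<gamma>) / \<gamma>))"
      proof (rule ennreal_leI)
        have "0 \<le> ?c * (A * (1 - r) powr \<gamma>) * ((1 - 0) powr (- \<gamma>) / \<gamma>)"
          using A \<gamma> tp[OF r] by (intro mult_nonneg_nonneg) auto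
        then show "?c * (A * (1 - r) powr \<gamma>) * ((1 - r) powr (- \<gamma>) / \<gamma>) - ?c * (A * (1 - r) powr \<gamma>) * ((1 - 0) powr (- \<gamma>) / \<gamma>)
          \<le> ?c * (A * (1 - r) powr \<gamma>) * ((1 - r) powr (- \<gamma>) / \<gamma>)" by linarith
      qed
      also have "?c * (A * (1 - r) powr \<gamma>) * ((1 - r) powr (- \<gamma>) / \<gamma>) = ?c * (A / \<gamma>)"
        using r by (simp add: powr_minus)
      finally show ?thesis .
    qed
    qed
    also have "\<dots> = ennreal ((real a + 1) * 2 ^ a * (2 * pi / tail \<nu> r) * (A / \<gamma>) + (real a + 1) * 2 ^ a * (2 * pi / tail \<nu> r) * 2 ^ a)"
      using A \<gamma> tp[OF r] by (intro ennreal_plus[symmetric] mult_nonneg_nonneg) auto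
    also have "(real a + 1) * 2 ^ a * (2 * pi / tail \<nu> r) * (A / \<gamma>) + (real a + 1) * 2 ^ a * (2 * pi / tail \<nu> r) * 2 ^ a = K / tail \<nu> r"
      by (simp add: K_def add_divide_distrib distrib_left mult_ac)
    finally show "(\<integral>\<^sup>+\<zeta>\<in>ball 0 1. ennreal (cmod (of_nat (a + 1) / (1 - cnj z * \<zeta>) ^ (a + 2)) * std_weight a (cmod \<zeta>) / tail \<nu> (cmod \<zeta>)) \<partial>lborel)
      \<le> ennreal (K / tail \<nu> (cmod z))"
      unfolding r_def .
  qed
qed

lemma bounded_projection_std_weight:
  assumes \<nu>: "\<nu> \<in> D_hat" "\<nu> \<in> D_check"
  obtains a where "bergman_projection_bounded (std_weight a) \<nu>"
proof -
  have rw: "radial_weight \<nu>" using \<nu>(1) by (simp add: D_hat_def)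
  note [measurable] = measurable_tail_norm[OF rw]
  obtain a where growth: "\<And>r t. 0 \<le> r \<Longrightarrow> r \<le> t \<Longrightarrow> t < 1 \<Longrightarrow> tail \<nu> r \<le> (2 * ((1 - r) / (1 - t))) ^ a * tail \<nu> t"
    using D_hat_growth[OF \<nu>(1)] by metis
  obtain A \<gamma> where decay: "A > 0" "\<gamma> > 0"
    "\<And>r t. 0 \<le> r \<Longrightarrow> r \<le> t \<Longrightarrow> t < 1 \<Longrightarrow> tail \<nu> t \<le> A * ((1 - t) / (1 - r)) powr \<gamma> * tail \<nu> r"
    using D_check_decay[OF \<nu>(2)] by metis
  let ?\<omega> = "std_weight a"
  let ?D = "lebesgue_on (ball (0::complex) 1)"
  have "\<exists>K\<ge>0. \<forall>z\<in>ball 0 1.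
    (\<integral>\<^sup>+\<zeta>\<in>ball 0 1. ennreal (cmod (of_nat (a + 1) / (1 - cnj z * \<zeta>) ^ (a + 2)) * ?\<omega> (cmod \<zeta>) / tail \<nu> (cmod \<zeta>)) \<partial>lborel)
      \<le> ennreal (K / tail \<nu> (cmod z))"
    by (rule kernel_integral_bound[OF rw, of a A \<gamma>]) (fact growth decay)+
  then obtain K where K: "K \<ge> 0" "\<And>z. z \<in> ball 0 1 \<Longrightarrow>
    (\<integral>\<^sup>+\<zeta>\<in>ball 0 1. ennreal (cmod (of_nat (a + 1) / (1 - cnj z * \<zeta>) ^ (a + 2)) * ?\<omega> (cmod \<zeta>) / tail \<nu> (cmod \<zeta>)) \<partial>lborel)
      \<le> ennreal (K / tail \<nu> (cmod z))"
    by blast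
  define B where "B z \<zeta> = cmod (of_nat (a + 1) / (1 - cnj z * \<zeta>) ^ (a + 2)) * ?\<omega> (cmod \<zeta>) / tail \<nu> (cmod \<zeta>)" for z \<zeta>
  note K = K(1) K(2)[folded B_def]
  note rw\<omega> = radial_weight_std[of a]
  have tp: "0 < tail \<nu> (cmod z)" if "z \<in> ball 0 1" for z :: complex using that by (intro tail_pos rw) auto
  have B: "integrable ?D (B z)" "(LINT \<zeta>|?D. B z \<zeta>) \<le> K / tail \<nu> (cmod z)" if z: "z \<in> ball 0 1" for z
  proof -
    have [measurable]: "B z \<in> borel_measurable ?D"
      by (rule measurable_lebesgue_on_borel) (unfold B_def, measurable)
    have B0: "0 \<le> B z \<zeta>" if "\<zeta> \<in> ball 0 1" for \<zeta>
      using tp[OF that] std_weight_le[of "cmod \<zeta>" a] that by (auto simp: B_def intro!: divide_nonneg_nonneg mult_nonneg_nonneg)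
    have nn: "(\<integral>\<^sup>+\<zeta>. ennreal (B z \<zeta>) \<partial>?D) \<le> ennreal (K / tail \<nu> (cmod z))"
      unfolding nn_integral_lebesgue_on_ball by (rule K(2)[OF z])
    show int: "integrable ?D (B z)"
    proof (rule integrableI_nonneg)
      show "(\<integral>\<^sup>+\<zeta>. ennreal (B z \<zeta>) \<partial>?D) < \<infinity>" using nn by (rule le_less_trans) simp
    qed (use B0 in \<open>auto intro!: AE_I2\<close>)
    have "ennreal (LINT \<zeta>|?D. B z \<zeta>) \<le> ennreal (K / tail \<nu> (cmod z))"
      using nn by (subst nn_integral_eq_integral[OF int, symmetric]) (use B0 in \<open>auto intro!: AE_I2\<close>)
    then show "(LINT \<zeta>|?D. B z \<zeta>) \<le> K / tail \<nu> (cmod z)"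
      using K(1) tp[OF z] by (subst (asm) ennreal_le_iff) auto
  qed
  have ker: "bergman_kernel ?\<omega> z \<zeta> = of_nat (a + 1) / (1 - cnj z * \<zeta>) ^ (a + 2)" if "z \<in> ball 0 1" "\<zeta> \<in> ball 0 1" for z \<zeta>
    using that mult_strict_mono'[of "cmod z" 1 "cmod \<zeta>" 1] by (intro bergman_kernel_std_weight) (auto simp: norm_mult)
  have "bergman_projection_bounded ?\<omega> \<nu>"
    unfolding bergman_projection_bounded_def
  \<comment> \<open>The factor 1/\<pi> is that of the normalised area measure.\<close>
  proof (intro exI[of _ "K / pi"] ballI)
    fix f assume f: "f \<in> L_inf \<nu>"
    obtain M where M: "M \<ge> 0" "weighted_norm \<nu> f = ereal M" "AE z in ?D. cmod (f z) \<le> M / tail \<nu> (cmod z)"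
      using L_infE[OF rw f] by metis
    have fm: "f \<in> borel_measurable ?D" using f by (simp add: L_inf_def)
    have bound: "AE \<zeta> in ?D. norm (bergman_integrand ?\<omega> f z \<zeta>) \<le> M * B z \<zeta>" if z: "z \<in> ball 0 1" for z
      using M(3) unfolding AE_lebesgue_on_ball
    proof eventually_elim
      case (elim \<zeta>)
      show ?case
      proof
        assume \<zeta>: "\<zeta> \<in> ball 0 1"
        have w: "0 \<le> ?\<omega> (cmod \<zeta>)" using std_weight_le[of "cmod \<zeta>" a] \<zeta> by auto
        have "norm (bergman_integrand ?\<omega> f z \<zeta>) = cmod (f \<zeta>) * (cmod (of_nat (a + 1) / (1 - cnj z * \<zeta>) ^ (a + 2)) * ?\<omega> (cmod \<zeta>))"
          using w unfolding bergman_integrand_def ker[OF z \<zeta>] norm_mult complex_mod_cnj norm_of_real by simp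
        also have "\<dots> \<le> M / tail \<nu> (cmod \<zeta>) * (cmod (of_nat (a + 1) / (1 - cnj z * \<zeta>) ^ (a + 2)) * ?\<omega> (cmod \<zeta>))"
          using elim \<zeta> w by (intro mult_right_mono mult_nonneg_nonneg) auto
        finally show "norm (bergman_integrand ?\<omega> f z \<zeta>) \<le> M * B z \<zeta>" by (simp add: B_def mult_ac)
      qed
    qed
    \<comment> \<open>At z = 0 the kernel is the constant a + 1 \<ge> 1, so the integrable function
      M \<open>B 0\<close> dominates f \<omega>.\<close>
    have int: "integrable ?D (\<lambda>\<zeta>. f \<zeta> * ?\<omega> (cmod \<zeta>))"
    proof (rule Bochner_Integration.integrable_bound)
      show "integrable ?D (\<lambda>\<zeta>. M * B 0 \<zeta>)" by (intro integrable_mult_right B) simp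
      show "(\<lambda>\<zeta>. f \<zeta> * ?\<omega> (cmod \<zeta>)) \<in> borel_measurable ?D"
        by (rule borel_measurable_times[OF fm measurable_lebesgue_on_borel]) measurable
      show "AE \<zeta> in ?D. norm (f \<zeta> * ?\<omega> (cmod \<zeta>)) \<le> norm (M * B 0 \<zeta>)"
        using M(3) unfolding AE_lebesgue_on_ball
      proof eventually_elim
        case (elim \<zeta>)
        show ?case
        proof
          assume \<zeta>: "\<zeta> \<in> ball 0 1"
          have w: "0 \<le> ?\<omega> (cmod \<zeta>)" using std_weight_le[of "cmod \<zeta>" a] \<zeta> by auto
          have "norm (f \<zeta> * ?\<omega> (cmod \<zeta>)) \<le> M / tail \<nu> (cmod \<zeta>) * ?\<omega> (cmod \<zeta>)"
            using elim \<zeta> w unfolding norm_mult norm_of_real abs_of_nonneg[OF w] by (intro mult_right_mono) auto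
          also have "\<dots> \<le> (real a + 1) * (M / tail \<nu> (cmod \<zeta>) * ?\<omega> (cmod \<zeta>))"
            using w M(1) tp[OF \<zeta>] mult_right_mono[of 1 "real a + 1" "M / tail \<nu> (cmod \<zeta>) * ?\<omega> (cmod \<zeta>)"] by auto
          also have "\<dots> = M * B 0 \<zeta>" by (simp add: B_def flip: of_nat_Suc)
          also have "\<dots> \<le> norm (M * B 0 \<zeta>)" by simp
          finally show "norm (f \<zeta> * ?\<omega> (cmod \<zeta>)) \<le> norm (M * B 0 \<zeta>)" .
        qed
      qed
    qed
    let ?P = "bergman_projection ?\<omega> f"
    have hol: "?P holomorphic_on ball 0 1" by (rule bergman_projection_holomorphic[OF rw\<omega> int])
    then have Pm: "?P \<in> borel_measurable ?D"
      by (intro continuous_imp_measurable_on_sets_lebesgue holomorphic_on_imp_continuous_on) auto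
    have le: "cmod (?P z) * tail \<nu> (cmod z) \<le> K / pi * M" if z: "z \<in> ball 0 1" for z
    proof -
      have "cmod (LINT \<zeta>|?D. bergman_integrand ?\<omega> f z \<zeta>) \<le> (LINT \<zeta>|?D. M * B z \<zeta>)"
      proof (rule order_trans[OF integral_norm_bound integral_mono_AE])
        show "integrable ?D (\<lambda>\<zeta>. norm (bergman_integrand ?\<omega> f z \<zeta>))"
          by (intro integrable_norm integrable_bergman_integrand[OF rw\<omega> int] z)
        show "integrable ?D (\<lambda>\<zeta>. M * B z \<zeta>)" by (intro integrable_mult_right B z)
      qed (rule bound[OF z])
      also have "\<dots> = M * (LINT \<zeta>|?D. B z \<zeta>)" by simp
      also have "\<dots> \<le> M * (K / tail \<nu> (cmod z))" using B(2)[OF z] M(1) by (rule mult_left_mono)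
      finally have "cmod (LINT \<zeta>|?D. bergman_integrand ?\<omega> f z \<zeta>) / pi \<le> M * (K / tail \<nu> (cmod z)) / pi"
        by (rule divide_right_mono) simp
      then have "cmod (?P z) \<le> M * (K / tail \<nu> (cmod z)) / pi"
        by (simp add: bergman_projection_def norm_divide)
      then show ?thesis using tp[OF z] by (simp add: field_simps)
    qed
    note wn = weighted_norm_le[OF rw Pm le]
    show "(\<forall>z\<in>ball 0 1. integrable ?D (bergman_integrand ?\<omega> f z)) \<and> ?P \<in> H_inf \<nu> \<and>
        weighted_norm \<nu> ?P \<le> ereal (K / pi) * weighted_norm \<nu> f"
      using integrable_bergman_integrand[OF rw\<omega> int] wn hol by (auto simp: H_inf_def M(2))
  qed
  then show ?thesis by (rule that)
qed

theorem corollary2: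
  fixes \<nu> :: "real \<Rightarrow> real"
  assumes "\<nu> \<in> D_hat"
  shows "((\<exists>\<omega>. radial_weight \<omega> \<and> bergman_projection_bounded \<omega> \<nu>) \<longleftrightarrow> \<nu> \<in> D_check) \<and>
         (\<nu> \<notin> D_check \<longrightarrow> (\<forall>\<omega>. radial_weight \<omega> \<longrightarrow> \<not> bergman_projection_bounded \<omega> \<nu>))"
proof -
  have "\<exists>\<omega>. radial_weight \<omega> \<and> bergman_projection_bounded \<omega> \<nu>" if "\<nu> \<in> D_check"
    using bounded_projection_std_weight[OF assms that] radial_weight_std by metis
  with bounded_projection_imp_D_check[OF assms] show ?thesis by blast
qed

end
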